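(* Let $\Omega\subset\mathbb{R}^n$ be a bounded domain, $X$ be a complete separable metric space and $p\in[1,\infty)$. Then a function $f\colon\Omega\to X$ lies in $W^{1,p}(\Omega;X)$ if and only if it is almost everywhere constant.
   Context: Banach spaces are real. $\mathbb{R}^n$ carries Lebesgue measure; a domain is a (nonempty) connected open set. Banach space valued functions: let $V$ be a Banach space. $f\colon\Omega\to V$ is measurable if it is measurable with respect to the Borel $\sigma$-algebra on $V$ and the $\sigma$-algebra of Lebesgue measurable subsets of $\Omega$; it is essentially separably valued if there is a null set $N\subset\Omega$ such that $f(\Omega\setminus N)$ is separable. $L^p(\Omega;V)$ consists of those $f\colon\Omega\to V$ that are measurable and essentially separably valued and for which $x\mapsto\|f(x)\|$ lies in $L^p(\Omega)$. $W^{1,p}(\Omega;V)$ consists of those $f\in L^p(\Omega;V)$ such that for every $j=1,\dots,n$ there is $f_j\in L^p(\Omega;V)$ with $$\int_\Omega \frac{\partial\varphi}{\partial x_j}(x)\, f(x)\,dx=-\int_\Omega\varphi(x)\, f_j(x)\,dx\quad\text{for every }\varphi\in C_0^\infty(\Omega)$$ in the sense of Bochner integrals, where $C_0^\infty(\Omega)$ denotes the smooth real functions with compact support in $\Omega$. Kuratowski embedding: let $X=(X,d)$ be a separable metric space and fix a dense sequence $(z_i)_{i\in\mathbb{N}}$ in $X$. The Kuratowski embedding is the isometric embedding $\kappa\colon X\to\ell^\infty=\ell^\infty(\mathbb{N})$, $\kappa(z)=\left(d(z,z_i)-d(z_i,z_1)\right)_{i\in\mathbb{N}}$. For the metric space $X$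 one defines (always via the Kuratowski embedding, also when $X$ happens to carry a linear structure) $$W^{1,p}(\Omega;X):=\{f\colon\Omega\to X \mid \kappa\circ f\in W^{1,p}(\Omega;\ell^\infty)\}.$$ *)

theory Defs
  imports "HOL-Analysis.Analysis"
begin

section \<open>Bochner integration without separability of the target\<close>

text \<open>The library relation \<open>has_bochner_integral\<close> requires a second countable target
  and hence does not apply to \<open>\<ell>\<^sup>\<infinity>\<close>.  The following is its definition verbatim, for an
  arbitrary normed space.  As the \<open>s i\<close> are simple, \<open>x \<mapsto> norm (F x - s i x)\<close> is measurable
  also for nonseparable targets.\<close>

definition has_bochner_int ::
    "'a measure \<Rightarrow> ('a \<Rightarrow> 'b::real_normed_vector) \<Rightarrow> 'b \<Rightarrow> bool" where
  "has_bochner_int M F v \<longleftrightarrow>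
     F \<in> borel_measurable M \<and>
     (\<exists>s. (\<forall>i. Bochner_Integration.simple_bochner_integrable M (s i)) \<and>
          (\<lambda>i. \<integral>\<^sup>+x. ennreal (norm (F x - s i x)) \<partial>M) \<longlonglongrightarrow> 0 \<and>
          (\<lambda>i. Bochner_Integration.simple_bochner_integral M (s i)) \<longlonglongrightarrow> v)"


section \<open>Lebesgue and Sobolev spaces of Banach space valued functions\<close>

text \<open>Functions on \<open>\<Omega>\<close> are represented by total functions; everything below depends only on
  their values on \<open>\<Omega>\<close>.\<close>

definition ess_separably_valued ::
    "(real^'n) set \<Rightarrow> (real^'n \<Rightarrow> 'b::topological_space) \<Rightarrow> bool" where
  "ess_separably_valued \<Omega> f \<longleftrightarrow>
     (\<exists>N \<in> null_sets (lebesgue_on \<Omega>). separable_space (top_of_set (f ` (\<Omega> - N))))"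

definition Lp_space :: "real \<Rightarrow> (real^'n) set \<Rightarrow> (real^'n \<Rightarrow> 'b::banach) set" where
  "Lp_space p \<Omega> =
     {f. f \<in> borel_measurable (lebesgue_on \<Omega>) \<and> ess_separably_valued \<Omega> f \<and>
         integrable (lebesgue_on \<Omega>) (\<lambda>x. norm (f x) powr p)}"

definition partial_deriv :: "'n \<Rightarrow> (real^'n \<Rightarrow> real) \<Rightarrow> real^'n \<Rightarrow> real" where
  "partial_deriv j \<phi> x = deriv (\<lambda>t. \<phi> (x + t *\<^sub>R axis j 1)) 0"

primrec Ck :: "nat \<Rightarrow> (real^'n \<Rightarrow> real) \<Rightarrow> bool" where
  "Ck 0 \<phi> \<longleftrightarrow> continuous_on UNIV \<phi>"
| "Ck (Suc k) \<phi> \<longleftrightarrow> \<phi> differentiable_on UNIV \<and> (\<forall>j. Ck k (partial_deriv j \<phi>))"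

text \<open>Test functions on \<open>\<Omega>\<close> are extended by zero to the whole space.\<close>

definition test_functions :: "(real^'n) set \<Rightarrow> (real^'n \<Rightarrow> real) set" where
  "test_functions \<Omega> =
     {\<phi>. (\<forall>k. Ck k \<phi>) \<and> compact (closure {x. \<phi> x \<noteq> 0}) \<and> closure {x. \<phi> x \<noteq> 0} \<subseteq> \<Omega>}"

text \<open>Both Bochner integrals in the integration by parts formula exist, and they are negatives
  of each other.  Existence is no restriction for \<open>f\<close> and \<open>g\<close> in \<open>Lp_space p \<Omega>\<close>, \<open>p \<ge> 1\<close>.\<close>

definition weak_partial_deriv ::
    "(real^'n) set \<Rightarrow> 'n \<Rightarrow> (real^'n \<Rightarrow> 'b::banach) \<Rightarrow> (real^'n \<Rightarrow> 'b) \<Rightarrow> bool" where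
  "weak_partial_deriv \<Omega> j f g \<longleftrightarrow>
     (\<forall>\<phi> \<in> test_functions \<Omega>. \<exists>v.
        has_bochner_int (lebesgue_on \<Omega>) (\<lambda>x. partial_deriv j \<phi> x *\<^sub>R f x) v \<and>
        has_bochner_int (lebesgue_on \<Omega>) (\<lambda>x. \<phi> x *\<^sub>R g x) (- v))"

definition sobolev_banach :: "real \<Rightarrow> (real^'n) set \<Rightarrow> (real^'n \<Rightarrow> 'b::banach) set" where
  "sobolev_banach p \<Omega> =
     {f \<in> Lp_space p \<Omega>. \<forall>j. \<exists>g \<in> Lp_space p \<Omega>. weak_partial_deriv \<Omega> j f g}"


section \<open>Metric space valued Sobolev functions via the Kuratowski embedding\<close>

text \<open>Every real function on the discrete space \<open>nat\<close> is continuous, so the bounded continuous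
  functions on \<open>nat\<close> with the supremum norm are \<open>\<ell>\<^sup>\<infinity>\<close>.\<close>

type_synonym linf = "nat \<Rightarrow>\<^sub>C real"

text \<open>The library proves completeness only over metric domains, and \<open>nat\<close> carries no
  metric space instance.\<close>

instance bcontfun :: (topological_space, complete_space) complete_space
proof
  fix F :: "nat \<Rightarrow> 'a \<Rightarrow>\<^sub>C 'b"
  assume F: "Cauchy F"
  have "uniformly_Cauchy_on UNIV (\<lambda>n. apply_bcontfun (F n))"
    unfolding uniformly_Cauchy_on_def
    using F dist_fun_lt_imp_dist_val_lt unfolding Cauchy_def by metis
  then obtain l where "uniform_limit UNIV (\<lambda>n. apply_bcontfun (F n)) l sequentially"
    using Cauchy_uniformly_convergent unfolding uniformly_convergent_on_def by metis
  from uniform_limit_bcontfunE[OF this sequentially_bot]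
  obtain L where "F \<longlonglongrightarrow> L"
    by metis
  then show "convergent F"
    by (rule convergentI)
qed

instance bcontfun :: (topological_space, banach) banach ..

definition kuratowski :: "(nat \<Rightarrow> 'a::metric_space) \<Rightarrow> 'a \<Rightarrow> linf" where
  "kuratowski z x = Bcontfun (\<lambda>i. dist x (z i) - dist (z i) (z 0))"

lemma kuratowski_apply:
  "apply_bcontfun (kuratowski z x) i = dist x (z i) - dist (z i) (z 0)"
proof -
  have "norm (dist x (z i) - dist (z i) (z 0)) \<le> dist x (z 0)" for i
    using dist_triangle[of x "z i" "z 0"] dist_triangle[of "z 0" "z i" x]
      dist_triangle[of x "z 0" "z i"] dist_triangle[of x "z i" "z 0"]
    by (simp add: dist_commute abs_le_iff)
  then have "bounded (range (\<lambda>i. dist x (z i) - dist (z i) (z 0)))"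
    by (auto simp: bounded_iff)
  then show ?thesis
    by (simp add: kuratowski_def bcontfun_def Bcontfun_inverse)
qed

definition sobolev_metric ::
    "(nat \<Rightarrow> 'a::metric_space) \<Rightarrow> real \<Rightarrow> (real^'n) set \<Rightarrow> (real^'n \<Rightarrow> 'a) set" where
  "sobolev_metric z p \<Omega> = {f. kuratowski z \<circ> f \<in> sobolev_banach p \<Omega>}"

end

theory Submission
  imports Defs
begin

text \<open>Write \<open>F\<close> for the composition of the Kuratowski embedding with \<open>f\<close>;
  its \<open>i\<close>-th coordinate is, up to an additive constant, the distance of \<open>f x\<close> to \<open>z i\<close>.
  A Sobolev function with values in the Banach space \<open>\<ell>\<^sup>\<infinity>\<close> is, in \<open>L\<^sup>1\<close>, differentiable in the
  norm: along a coordinate direction \<open>e\<close>, the second difference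
  \<open>F (x + h e) - 2 F x + F (x - h e)\<close> has \<open>L\<^sup>1\<close> norm \<open>o(h)\<close>.  Distance functions, however, have a
  kink.  Choosing \<open>z i\<close> close to \<open>f x\<close>, the \<open>i\<close>-th coordinate of the second difference is nearly
  \<open>dist (f (x + h e)) (f x) + dist (f (x - h e)) (f x)\<close>, so for every \<open>x\<close>
  \<open>\<parallel>F (x + h e) - F x\<parallel> \<le> \<parallel>F (x + h e) - 2 F x + F (x - h e)\<parallel>\<close>,
  which is \<open>kuratowski_second_difference\<close>.  Hence already the first difference of \<open>F\<close> is \<open>o(h)\<close>
  in \<open>L\<^sup>1\<close>.  Cutting a segment of length \<open>t\<close> into \<open>N\<close> equal pieces and summing, the difference of
  \<open>F\<close> over the segment has norm at most \<open>N o(t / N)\<close>, which tends to \<open>0\<close>.  So \<open>F\<close> is invariant under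
  small translations, hence almost everywhere constant near each point, and almost everywhere
  constant by connectedness.

  The estimate of the second difference has two ingredients.  First, a scalar function \<open>u\<close> with
  weak derivative \<open>g\<close> satisfies \<open>u (x + h e) - u x = \<integral>\<^sub>0\<^sup>h g (x + t e) dt\<close> for almost every \<open>x\<close>
  (\<open>AE_difference_eq_line_integral\<close>); this is applied to each of the countably many coordinates.
  The second difference is then controlled by differences \<open>g (y - h e) - g y\<close>, with
  a supremum over the coordinates inside the integral.  Second, the translations act
  continuously on \<open>L\<^sup>1\<close> functions with values in \<open>\<ell>\<^sup>\<infinity>\<close> (\<open>L1_sup_translation_null\<close>), because Bochner
  integrable functions are limits of functions of finite rank (\<open>finite_rank_approximation\<close>).
  Here it is essential that the weak derivative is a Bochner integrable function: on an interval,
  the curve \<open>t \<mapsto> kuratowski z t\<close> has bounded weak derivatives in all coordinates, although it is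
  isometric.

  The coordinates are replaced by Borel functions on the whole space, so that Fubini's theorem is
  available for Lebesgue measure on products of Borel \<open>\<sigma>\<close>-algebras.  The locale
  \<open>kuratowski_sobolev_family\<close> collects what remains of \<open>F\<close> after this reduction.

  Conversely, an almost everywhere constant map is integrable because the domain has finite
  measure, and it has weak derivative \<open>0\<close> because a partial derivative of a test function has
  integral \<open>0\<close>.\<close>

section \<open>Smooth bump functions on boxes\<close>

text \<open>The derivative is existentially quantified, rather than given by \<open>deriv\<close>, so that closure under
  sums and products follows by induction without computing derivatives.\<close>
primrec smooth_upto :: "nat \<Rightarrow> (real \<Rightarrow> real) \<Rightarrow> bool" where
  "smooth_upto 0 f \<longleftrightarrow> continuous_on UNIV f"
| "smooth_upto (Suc k) f \<longleftrightarrow>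
     (\<exists>f'. (\<forall>x. (f has_real_derivative f' x) (at x)) \<and> smooth_upto k f')"

lemma smooth_upto_SucD: "smooth_upto (Suc k) f \<Longrightarrow> smooth_upto k f"
proof (induction k arbitrary: f)
  case 0
  then show ?case
    by (metis DERIV_isCont continuous_at_imp_continuous_on smooth_upto.simps)
next
  case (Suc k)
  then show ?case by (meson smooth_upto.simps(2))
qed

lemma smooth_upto_add: "smooth_upto k f \<Longrightarrow> smooth_upto k g \<Longrightarrow> smooth_upto k (\<lambda>t. f t + g t)"
proof (induction k arbitrary: f g)
  case 0
  then show ?case by (auto intro: continuous_intros)
next
  case (Suc k)
  then obtain f' g' where "\<And>x. (f has_real_derivative f' x) (at x)" "smooth_upto k f'"
    "\<And>x. (g has_real_derivative g' x) (at x)" "smooth_upto k g'"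
    by auto
  with Suc.IH show ?case
    by (auto intro!: exI[of _ "\<lambda>x. f' x + g' x"] derivative_intros)
qed

lemma smooth_upto_mult: "smooth_upto k f \<Longrightarrow> smooth_upto k g \<Longrightarrow> smooth_upto k (\<lambda>t. f t * g t)"
proof (induction k arbitrary: f g)
  case 0
  then show ?case by (auto intro: continuous_intros)
next
  case (Suc k)
  then obtain f' g' where *: "\<And>x. (f has_real_derivative f' x) (at x)" "smooth_upto k f'"
    "\<And>x. (g has_real_derivative g' x) (at x)" "smooth_upto k g'"
    by auto
  have "smooth_upto k (\<lambda>x. f' x * g x + g' x * f x)"
    using Suc.prems[THEN smooth_upto_SucD] * by (intro smooth_upto_add Suc.IH)
  with * show ?case
    by (auto intro!: exI[of _ "\<lambda>x. f' x * g x + g' x * f x"] DERIV_mult)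
qed

text \<open>The factor \<open>C\<close> makes the induction go through: differentiating produces the factor \<open>m\<close>.\<close>
lemma smooth_upto_affine: "smooth_upto k f \<Longrightarrow> smooth_upto k (\<lambda>t. C * f (m * t + b))"
proof (induction k arbitrary: f C)
  case 0
  then show ?case
    by (auto intro!: continuous_intros continuous_on_compose2[of UNIV f])
next
  case (Suc k)
  then obtain f' where *: "\<And>x. (f has_real_derivative f' x) (at x)" "smooth_upto k f'"
    by auto
  have "((\<lambda>t. C * f (m * t + b)) has_real_derivative (C * m) * f' (m * x + b)) (at x)" for x
  proof -
    have "((\<lambda>t. f (m * t + b)) has_real_derivative f' (m * x + b) * m) (at x)"
      by (rule DERIV_chain2[OF *(1)]) (auto intro!: derivative_eq_intros)
    from DERIV_cmult[OF this, of C] show ?thesis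
      by (simp add: mult_ac)
  qed
  with * Suc.IH[of f' "C * m"] show ?case
    by (auto intro!: exI[of _ "\<lambda>x. (C * m) * f' (m * x + b)"])
qed

text \<open>Smoothness of \<open>exp (- c / t)\<close> is proved by exhibiting a family of functions closed under
  differentiation, which avoids formulas for iterated derivatives.\<close>
lemma smooth_upto_closed_family:
  assumes "\<And>f. f \<in> S \<Longrightarrow> \<exists>f'\<in>S. \<forall>x. (f has_real_derivative f' x) (at x)" "f \<in> S"
  shows "smooth_upto k f"
  using assms(2)
proof (induction k arbitrary: f)
  case 0
  with assms(1) show ?case
    by (metis DERIV_isCont continuous_at_imp_continuous_on smooth_upto.simps(1))
next
  case (Suc k)
  with assms(1) show ?case by fastforce
qed

lemma tendsto_poly_times_exp_at_top:
  fixes P :: "real poly"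
  assumes "c > 0"
  shows "((\<lambda>s. poly P s * exp (- (c * s))) \<longlongrightarrow> 0) at_top"
proof -
  have "((\<lambda>s. s ^ i * exp (- (c * s))) \<longlongrightarrow> 0) at_top" for i
  proof -
    have "filterlim (\<lambda>s. c * s) at_top at_top"
      using assms by (intro filterlim_tendsto_pos_mult_at_top[OF tendsto_const] filterlim_ident)
    then have "((\<lambda>s. (c * s) ^ i / exp (c * s)) \<longlongrightarrow> 0) at_top"
      by (rule filterlim_compose[OF tendsto_power_div_exp_0])
    then have "((\<lambda>s. (1 / c ^ i) * ((c * s) ^ i / exp (c * s))) \<longlongrightarrow> (1 / c ^ i) * 0) at_top"
      by (intro tendsto_intros)
    then show ?thesis
      using assms by (simp add: exp_minus field_simps)
  qed
  then have "((\<lambda>s. \<Sum>i\<le>degree P. coeff P i * (s ^ i * exp (- (c * s)))) \<longlongrightarrow>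
      (\<Sum>i\<le>degree P. coeff P i * 0)) at_top"
    by (intro tendsto_intros)
  then show ?thesis
    by (simp add: poly_altdef sum_distrib_left sum_distrib_right mult_ac)
qed

text \<open>The polynomial factor makes this family closed under differentiation.  The parameter \<open>c\<close> is the
  smoothing scale: for \<open>P = 1\<close> the functions increase to the indicator of the positive reals as
  \<open>c\<close> decreases to \<open>0\<close>.\<close>
definition exp_step :: "real poly \<Rightarrow> real \<Rightarrow> real \<Rightarrow> real" where
  "exp_step P c t = (if 0 < t then poly P (1 / t) * exp (- (c / t)) else 0)"

text \<open>At \<open>t = 0\<close> the difference quotient from the right is \<open>s * poly P s * exp (- c * s)\<close> with
  \<open>s = 1 / t\<close>, so exponential decay beats the polynomial.\<close>
lemma has_real_derivative_exp_step:
  assumes "c > 0"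
  shows "(exp_step P c has_real_derivative exp_step ([:0,0,1:] * (smult c P - pderiv P)) c t) (at t)"
proof -
  consider "t > 0" | "t < 0" | "t = 0" by linarith
  then show ?thesis
  proof cases
    case 1
    have "((\<lambda>t. poly P (1 / t)) has_real_derivative poly (pderiv P) (1 / t) * (- 1 / t\<^sup>2)) (at t)"
      by (rule DERIV_chain2[OF poly_DERIV])
        (use 1 in \<open>auto intro!: derivative_eq_intros simp: power2_eq_square\<close>)
    moreover have "((\<lambda>t. exp (- (c / t))) has_real_derivative exp (- (c / t)) * (c / t\<^sup>2)) (at t)"
      by (rule DERIV_chain2[OF DERIV_exp])
        (use 1 in \<open>auto intro!: derivative_eq_intros simp: power2_eq_square\<close>)
    ultimately have "((\<lambda>t. poly P (1 / t) * exp (- (c / t))) has_real_derivative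
        exp_step ([:0,0,1:] * (smult c P - pderiv P)) c t) (at t)"
      by (rule DERIV_cong[OF DERIV_mult])
        (use 1 in \<open>simp add: exp_step_def field_simps power2_eq_square\<close>)
    then show ?thesis
      by (rule DERIV_cong_ev[THEN iffD1, rotated 3])
        (use 1 in \<open>auto simp: exp_step_def intro!: eventually_mono[OF eventually_nhds_in_open[of "{0<..}"]]\<close>)
  next
    case 2
    have "((\<lambda>t. 0) has_real_derivative exp_step ([:0,0,1:] * (smult c P - pderiv P)) c t) (at t)"
      using 2 by (auto simp: exp_step_def)
    then show ?thesis
      by (rule DERIV_cong_ev[THEN iffD1, rotated 3])
        (use 2 in \<open>auto simp: exp_step_def intro!: eventually_mono[OF eventually_nhds_in_open[of "{..<0}"]]\<close>)
  next
    case 3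
    have "((\<lambda>s. poly (pCons 0 P) s * exp (- (c * s))) \<longlongrightarrow> 0) at_top"
      by (rule tendsto_poly_times_exp_at_top[OF assms])
    then have "((\<lambda>t. poly (pCons 0 P) (inverse t) * exp (- (c * inverse t))) \<longlongrightarrow> 0) (at_right 0)"
      by (rule filterlim_compose) (rule filterlim_inverse_at_top_right)
    then have "((\<lambda>t. exp_step P c t / t) \<longlongrightarrow> 0) (at_right 0)"
      by (rule Lim_transform_eventually)
        (auto simp: exp_step_def field_simps eventually_at_filter)
    moreover have "((\<lambda>t. exp_step P c t / t) \<longlongrightarrow> 0) (at_left 0)"
      by (rule Lim_transform_eventually[OF tendsto_const])
        (auto simp: exp_step_def eventually_at_filter)
    ultimately have "((\<lambda>t. exp_step P c t / t) \<longlongrightarrow> 0) (at 0)"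
      by (simp add: filterlim_at_split)
    then show ?thesis
      using 3 by (simp add: has_field_derivative_iff exp_step_def)
  qed
qed

lemma smooth_upto_exp_step: "c > 0 \<Longrightarrow> smooth_upto k (exp_step P c)"
proof (rule smooth_upto_closed_family[where S="range (\<lambda>P. exp_step P c)"])
  fix f
  assume "0 < c" "f \<in> range (\<lambda>P. exp_step P c)"
  then show "\<exists>f'\<in>range (\<lambda>P. exp_step P c). \<forall>x. (f has_real_derivative f' x) (at x)"
    using has_real_derivative_exp_step by blast
qed simp

text \<open>A partial derivative differentiates a single factor, so it is again a product of functions of one
  coordinate each; the induction stays within products.\<close>
lemma Ck_prod:
  fixes g :: "'n::finite \<Rightarrow> real \<Rightarrow> real"
  assumes "\<And>i. smooth_upto k (g i)"
  shows "Ck k (\<lambda>x::real^'n. \<Prod>i\<in>UNIV. g i (x $ i))"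
  using assms
proof (induction k arbitrary: g)
  case 0
  then show ?case
    by (auto intro!: continuous_on_prod continuous_on_compose2[of UNIV "g _" _ "\<lambda>x. x $ _"] continuous_on_component continuous_on_id)
next
  case (Suc k)
  then obtain g' where g': "\<And>i x. (g i has_real_derivative g' i x) (at x)" "\<And>i. smooth_upto k (g' i)"
    by (simp, metis)
  have "((\<lambda>y::real^'n. \<Prod>i\<in>UNIV. g i (y $ i)) has_derivative
       (\<lambda>h. \<Sum>i\<in>UNIV. (h $ i * g' i (x $ i)) * (\<Prod>j\<in>UNIV - {i}. g j (x $ j)))) (at x)" for x
    by (rule has_derivative_prod)
      (auto intro!: DERIV_compose_FDERIV[OF g'(1)] bounded_linear_imp_has_derivative bounded_linear_vec_nth)
  then have "(\<lambda>x::real^'n. \<Prod>i\<in>UNIV. g i (x $ i)) differentiable_on UNIV"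
    by (auto simp: differentiable_on_def differentiable_def)
  moreover have "Ck k (partial_deriv j (\<lambda>x::real^'n. \<Prod>i\<in>UNIV. g i (x $ i)))" for j
  proof -
    have "partial_deriv j (\<lambda>x::real^'n. \<Prod>i\<in>UNIV. g i (x $ i)) =
        (\<lambda>x. \<Prod>i\<in>UNIV. (if i = j then g' i else g i) (x $ i))"
    proof
      fix x :: "real^'n"
      have "(\<lambda>t. \<Prod>i\<in>UNIV. g i ((x + t *\<^sub>R axis j 1) $ i)) =
          (\<lambda>t. g j (x $ j + t) * (\<Prod>i\<in>UNIV - {j}. g i (x $ i)))"
        by (subst prod.remove[of _ j]) (auto simp: axis_def intro!: prod.cong ext)
      moreover have "((\<lambda>t. g j (x $ j + t) * (\<Prod>i\<in>UNIV - {j}. g i (x $ i))) has_real_derivative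
          g' j (x $ j) * (\<Prod>i\<in>UNIV - {j}. g i (x $ i))) (at 0)"
        by (auto intro!: derivative_eq_intros DERIV_chain2[where f="g j"] g')
      ultimately have "partial_deriv j (\<lambda>x::real^'n. \<Prod>i\<in>UNIV. g i (x $ i)) x =
          g' j (x $ j) * (\<Prod>i\<in>UNIV - {j}. g i (x $ i))"
        by (simp add: partial_deriv_def DERIV_imp_deriv)
      also have "\<dots> = (\<Prod>i\<in>UNIV. (if i = j then g' i else g i) (x $ i))"
        by (subst (2) prod.remove[of _ j]) (auto intro!: prod.cong)
      finally show "partial_deriv j (\<lambda>x::real^'n. \<Prod>i\<in>UNIV. g i (x $ i)) x = \<dots>" .
    qed
    moreover have "Ck k (\<lambda>x::real^'n. \<Prod>i\<in>UNIV. (if i = j then g' i else g i) (x $ i))"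
      using g'(2) Suc.prems[THEN smooth_upto_SucD] by (intro Suc.IH) simp
    ultimately show ?thesis by simp
  qed
  ultimately show ?case by simp
qed

definition box_bump :: "real \<Rightarrow> real^'n \<Rightarrow> real^'n \<Rightarrow> real^'n \<Rightarrow> real" where
  "box_bump c a b x = (\<Prod>i\<in>UNIV. exp_step 1 c (x $ i - a $ i) * exp_step 1 c (b $ i - x $ i))"

lemma exp_step_one_bounds: "0 \<le> exp_step 1 c t" "c > 0 \<Longrightarrow> exp_step 1 c t \<le> 1"
  by (auto simp: exp_step_def)

lemma box_bump_bounds: "0 \<le> box_bump c a b x" "c > 0 \<Longrightarrow> box_bump c a b x \<le> 1"
  unfolding box_bump_def
  by (auto intro!: prod_nonneg prod_le_1 mult_nonneg_nonneg mult_le_one exp_step_one_bounds)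

lemma box_bump_eq_0_iff: "box_bump c a b x = 0 \<longleftrightarrow> x \<notin> box a b"
  by (fastforce simp: box_bump_def exp_step_def mem_box_cart)

lemma box_bump_translate: "box_bump c a b (x - v) = box_bump c (a + v) (b + v) x"
  by (simp add: box_bump_def algebra_simps)

lemma Ck_box_bump: "c > 0 \<Longrightarrow> Ck k (box_bump c a b)"
proof -
  assume c: "c > 0"
  have "smooth_upto k (\<lambda>t. exp_step 1 c (t - a $ i) * exp_step 1 c (b $ i - t))" for i
    using smooth_upto_affine[OF smooth_upto_exp_step[OF c], of k 1 1 1 "- a $ i"]
      smooth_upto_affine[OF smooth_upto_exp_step[OF c], of k 1 1 "-1" "b $ i"]
    by (intro smooth_upto_mult) simp_all
  from Ck_prod[OF this] show ?thesis
    unfolding box_bump_def[abs_def] .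
qed

lemma box_bump_test_function:
  assumes "c > 0" "cbox a b \<subseteq> \<Omega>"
  shows "box_bump c a b \<in> test_functions \<Omega>"
proof -
  have "closure {x. box_bump c a b x \<noteq> 0} \<subseteq> cbox a b"
    by (rule closure_minimal) (auto simp: box_bump_eq_0_iff box_subset_cbox[THEN subsetD])
  moreover from this have "compact (closure {x. box_bump c a b x \<noteq> 0})"
    by (meson bounded_cbox bounded_subset closed_closure compact_eq_bounded_closed)
  ultimately show ?thesis
    using assms Ck_box_bump by (auto simp: test_functions_def)
qed

text \<open>This is why the smoothing scale is kept as a parameter: testing against bumps determines
  the integrals over boxes.\<close>
lemma box_bump_tendsto_indicator:
  "(\<lambda>k. box_bump (1 / real (Suc k)) a b x) \<longlonglongrightarrow> indicator (box a b) x"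
proof (cases "x \<in> box a b")
  case True
  have "(\<lambda>k. 1 / real (Suc k) / s) \<longlonglongrightarrow> 0" for s
    using tendsto_divide_zero[OF LIMSEQ_inverse_real_of_nat, of s] by (simp add: divide_inverse)
  then have *: "(\<lambda>k. exp (- (1 / real (Suc k) / s))) \<longlonglongrightarrow> exp (- 0)" for s
    by (intro tendsto_intros)
  have "(\<lambda>k. \<Prod>i\<in>UNIV. exp (- (1 / real (Suc k) / (x $ i - a $ i))) *
      exp (- (1 / real (Suc k) / (b $ i - x $ i)))) \<longlonglongrightarrow> (\<Prod>i\<in>(UNIV::'a set). exp (-0) * exp (-0))"
    by (intro tendsto_prod tendsto_mult *)
  with True show ?thesis
    by (simp add: box_bump_def exp_step_def mem_box_cart)
next
  case False
  then show ?thesis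
    using box_bump_eq_0_iff[of _ a b x] by simp
qed

section \<open>The fundamental lemma of the calculus of variations\<close>

text \<open>The boxes generate the Borel sets and are stable under intersection, so the integral of \<open>w\<close> cut
  off outside \<open>box p q\<close> vanishes over every Borel set.\<close>
lemma AE_zero_if_integral_subboxes_zero:
  fixes w :: "'a::euclidean_space \<Rightarrow> real"
  assumes w: "integrable lborel w"
    and zero: "\<And>a b. box a b \<subseteq> box p q \<Longrightarrow> (LINT x:box a b|lborel. w x) = 0"
  shows "AE x in lborel. x \<in> box p q \<longrightarrow> w x = 0"
proof -
  define v where "v x = indicator (box p q) x * w x" for x
  have v: "integrable lborel v"
    unfolding v_def using integrable_mult_indicator[OF _ w, of "box p q"] by simp
  have set_int: "set_integrable lborel A v" if "A \<in> sets borel" for A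
    using integrable_mult_indicator[OF _ v, of A] that by (simp add: set_integrable_def)
  have box0: "(LINT x:box a b|lborel. v x) = 0" for a b
  proof -
    obtain c d where cd: "box a b \<inter> box p q = box c d"
      by (rule that[OF box_Int_box])
    have "(LINT x:box a b|lborel. v x) = (LINT x:box c d|lborel. w x)"
      unfolding set_lebesgue_integral_def v_def
      by (rule Bochner_Integration.integral_cong) (auto simp: indicator_def simp flip: cd)
    with zero[of c d] cd show ?thesis by auto
  qed
  have UNIV0: "(LINT x|lborel. v x) = 0"
    using box0[of p q] by (simp add: set_lebesgue_integral_def v_def flip: mult.assoc indicator_inter_arith)
  have "(LINT x:A|lborel. v x) = 0" if "A \<in> sigma_sets UNIV (range (\<lambda>(a, b). box a b))" for A
  proof -
    have borel: "A \<in> sets borel" if "A \<in> sigma_sets UNIV (range (\<lambda>(a, b). box a b :: 'a set))" for A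
      using that by (simp add: borel_eq_box)
    have "Int_stable (range (\<lambda>(a, b). box a b :: 'a set))"
      by (auto simp: Int_stable_def box_Int_box)
    moreover have "range (\<lambda>(a, b). box a b :: 'a set) \<subseteq> Pow UNIV"
      by simp
    ultimately show ?thesis
      using that
    proof (induction A rule: sigma_sets_induct_disjoint)
      case (basic A)
      then show ?case using box0 by auto
    next
      case empty
      then show ?case by (simp add: set_lebesgue_integral_def)
    next
      case (compl A)
      have "(LINT x|lborel. v x) = (LINT x:A|lborel. v x) + (LINT x:UNIV - A|lborel. v x)"
        using borel[OF compl(1)]
        by (subst set_integral_Un[symmetric]) (auto intro!: set_int simp: set_lebesgue_integral_def)
      with compl UNIV0 show ?case by simp
    next
      case (union A)
      then have Ab: "A i \<in> sets borel" for i
        by (intro borel) auto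
      have "(LINT x:(\<Union>i. A i)|lborel. v x) = (\<Sum>i. (LINT x:A i|lborel. v x))"
        using union(1) Ab by (intro lebesgue_integral_countable_add set_int sets.countable_UN)
          (auto simp: disjoint_family_on_def)
      with union show ?case by simp
    qed
  qed
  then have "AE x in lborel. v x = 0"
    by (intro density_unique_real[OF v, of "\<lambda>_. 0", simplified]) (simp_all add: borel_eq_box)
  then show ?thesis
    by eventually_elim (auto simp: v_def)
qed

lemma AE_zero_if_integral_box_bumps_zero:
  fixes w :: "real^'n \<Rightarrow> real"
  assumes w: "integrable lborel w"
    and zero: "\<And>c a b. c > 0 \<Longrightarrow> cbox a b \<subseteq> cbox p q \<Longrightarrow> (LINT x|lborel. box_bump c a b x * w x) = 0"
  shows "AE x in lborel. x \<in> box p q \<longrightarrow> w x = 0"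
proof (rule AE_zero_if_integral_subboxes_zero[OF w])
  fix a b
  assume ab: "box a b \<subseteq> box p q"
  show "(LINT x:box a b|lborel. w x) = 0"
  proof (cases "box a b = {}")
    case True
    then show ?thesis by (simp add: set_lebesgue_integral_def)
  next
    case False
    with ab have sub: "cbox a b \<subseteq> cbox p q"
      by (metis closure_box closure_mono subset_empty)
    have [measurable]: "box_bump (1 / real (Suc k)) a b \<in> borel_measurable borel" for k
      using Ck_box_bump[of "1 / real (Suc k)" 0 a b] by (simp add: borel_measurable_continuous_onI)
    have [measurable]: "w \<in> borel_measurable borel"
      using w by auto
    have "(\<lambda>k. LINT x|lborel. box_bump (1 / real (Suc k)) a b x * w x) \<longlonglongrightarrow>
        (LINT x|lborel. indicator (box a b) x * w x)"
    proof (rule integral_dominated_convergence[where w="\<lambda>x. \<bar>w x\<bar>"])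
      show "AE x in lborel. (\<lambda>k. box_bump (1 / real (Suc k)) a b x * w x) \<longlonglongrightarrow>
          indicator (box a b) x * w x"
        by (intro AE_I2 tendsto_mult box_bump_tendsto_indicator tendsto_const)
      show "AE x in lborel. norm (box_bump (1 / real (Suc k)) a b x * w x) \<le> \<bar>w x\<bar>" for k
        using box_bump_bounds[of "1 / real (Suc k)" a b]
        by (intro AE_I2) (simp add: abs_mult mult_left_le_one_le)
      show "(\<lambda>x. box_bump (1 / real (Suc k)) a b x * w x) \<in> borel_measurable lborel" for k
        by measurable
    qed (use w in auto)
    moreover have "(LINT x|lborel. box_bump (1 / real (Suc k)) a b x * w x) = 0" for k
      using sub by (intro zero) auto
    ultimately have "(LINT x|lborel. indicator (box a b) x * w x) = 0"
      by (simp add: LIMSEQ_const_iff)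
    then show ?thesis by (simp add: set_lebesgue_integral_def)
  qed
qed

section \<open>Weak derivatives and differences\<close>

lemma lborel_translate:
  fixes f :: "'a::euclidean_space \<Rightarrow> 'b::{banach, second_countable_topology}"
  shows lborel_integrable_translate: "integrable lborel f \<Longrightarrow> integrable lborel (\<lambda>x. f (x + v))"
    and lborel_integral_translate: "f \<in> borel_measurable borel \<Longrightarrow> (LINT x|lborel. f (x + v)) = (LINT x|lborel. f x)"
proof -
  show "integrable lborel f \<Longrightarrow> integrable lborel (\<lambda>x. f (x + v))"
    using integrable_distr[of "(+) v" lborel borel f] by (simp add: lborel_distr_plus add.commute)
  show "f \<in> borel_measurable borel \<Longrightarrow> (LINT x|lborel. f (x + v)) = (LINT x|lborel. f x)"
    using integral_distr[of "(+) v" lborel borel f] by (simp add: lborel_distr_plus add.commute)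
qed

lemma lborel_nn_integral_translate:
  fixes f :: "'a::euclidean_space \<Rightarrow> ennreal"
  assumes "f \<in> borel_measurable borel"
  shows "(\<integral>\<^sup>+x. f (x + v) \<partial>lborel) = (\<integral>\<^sup>+x. f x \<partial>lborel)"
  using nn_integral_distr[of "(+) v" lborel borel f] assms
  by (simp add: lborel_distr_plus add.commute)

lemma lborel_AE_translate:
  fixes v :: "'a::euclidean_space"
  assumes "AE x in lborel. P x"
  shows "AE x in lborel. P (x + v)"
proof -
  have "AE x in distr lborel borel ((+) v). P x"
    by (subst lborel_distr_plus) (rule assms)
  then have "AE x in lborel. P (v + x)"
    by (rule AE_distrD[rotated]) simp
  then show ?thesis by (simp add: add.commute)
qed

lemma test_functionD:
  fixes \<Omega> :: "(real^'n) set"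
  assumes "\<phi> \<in> test_functions \<Omega>"
  shows test_function_continuous: "continuous_on UNIV \<phi>"
    and test_function_continuous_deriv: "continuous_on UNIV (partial_deriv j \<phi>)"
    and test_function_DERIV: "((\<lambda>t. \<phi> (x + t *\<^sub>R axis j 1)) has_real_derivative
          partial_deriv j \<phi> (x + t *\<^sub>R axis j 1)) (at t)"
    and test_function_outside: "x \<notin> \<Omega> \<Longrightarrow> \<phi> x = 0"
    and test_function_deriv_outside: "x \<notin> \<Omega> \<Longrightarrow> partial_deriv j \<phi> x = 0"
    and test_function_bounded: "\<exists>C. \<forall>x. \<bar>\<phi> x\<bar> \<le> C"
    and test_function_deriv_bounded: "\<exists>C. \<forall>x. \<bar>partial_deriv j \<phi> x\<bar> \<le> C"
proof -
  let ?K = "closure {x. \<phi> x \<noteq> 0}"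
  have Ck: "Ck k \<phi>" for k
    using assms by (simp add: test_functions_def)
  have K: "compact ?K" "?K \<subseteq> \<Omega>"
    using assms by (simp_all add: test_functions_def)
  show 1: "continuous_on UNIV \<phi>"
    using Ck[of 0] by simp
  show 2: "continuous_on UNIV (partial_deriv j \<phi>)" for j
    using Ck[of "Suc 0"] by simp
  have diff: "\<phi> differentiable (at y)" for y
    using Ck[of "Suc 0"] by (simp add: differentiable_on_def)
  have zero: "((\<lambda>t. \<phi> (x + t *\<^sub>R axis j 1)) has_real_derivative partial_deriv j \<phi> x) (at 0)" for x j
  proof -
    have "(\<phi> \<circ> (\<lambda>t. x + t *\<^sub>R axis j 1)) differentiable (at (0::real))"
      by (rule differentiable_chain_at)
        (auto intro!: diff bounded_linear_imp_differentiable bounded_linear_scaleR_left differentiable_add)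
    then show ?thesis
      unfolding partial_deriv_def
      by (simp add: DERIV_deriv_iff_real_differentiable o_def)
  qed
  show "((\<lambda>t. \<phi> (x + t *\<^sub>R axis j 1)) has_real_derivative
          partial_deriv j \<phi> (x + t *\<^sub>R axis j 1)) (at t)"
    using zero[of "x + t *\<^sub>R axis j 1" j]
      DERIV_shift[of "\<lambda>t. \<phi> (x + t *\<^sub>R axis j 1)" _ 0 t]
    by (simp add: algebra_simps)
  have K0: "\<phi> x = 0" if "x \<notin> ?K" for x
    using that closure_subset[of "{x. \<phi> x \<noteq> 0}"] by blast
  have K0': "partial_deriv j \<phi> x = 0" if "x \<notin> ?K" for x j
  proof -
    have "open {t::real. x + t *\<^sub>R axis j 1 \<in> - ?K}"
      by (rule open_vimage[of "- ?K" "\<lambda>t. x + t *\<^sub>R axis j 1", unfolded vimage_def])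
        (auto intro!: continuous_intros)
    from eventually_nhds_in_open[OF this, of 0] that
    have "eventually (\<lambda>t. x + t *\<^sub>R axis j 1 \<in> - ?K) (nhds 0)"
      by simp
    then have "eventually (\<lambda>t. \<phi> (x + t *\<^sub>R axis j 1) = 0) (nhds 0)"
      by eventually_elim (rule K0, simp)
    then have "deriv (\<lambda>t. \<phi> (x + t *\<^sub>R axis j 1)) 0 = deriv (\<lambda>t. 0) (0::real)"
      by (intro deriv_cong_ev) auto
    then show ?thesis by (simp add: partial_deriv_def)
  qed
  show "x \<notin> \<Omega> \<Longrightarrow> \<phi> x = 0" "x \<notin> \<Omega> \<Longrightarrow> partial_deriv j \<phi> x = 0"
    by (rule K0, use K(2) in blast) (rule K0', use K(2) in blast)
  have "\<exists>C. \<forall>x. \<bar>f x\<bar> \<le> C" if "continuous_on UNIV f" "\<And>x. x \<notin> ?K \<Longrightarrow> f x = 0" for f :: "real^'n \<Rightarrow> real"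
  proof -
    have "bounded (f ` ?K)"
      by (intro compact_imp_bounded compact_continuous_image K continuous_on_subset[OF that(1)]) simp
    then obtain C where "C > 0" "\<And>x. x \<in> ?K \<Longrightarrow> \<bar>f x\<bar> \<le> C"
      by (auto simp: bounded_pos)
    with that(2) have "\<bar>f x\<bar> \<le> C" for x
      by (cases "x \<in> ?K") auto
    then show ?thesis by blast
  qed
  note bounded = this
  show "\<exists>C. \<forall>x. \<bar>\<phi> x\<bar> \<le> C"
    by (rule bounded[OF 1]) (rule K0)
  show "\<exists>C. \<forall>x. \<bar>partial_deriv j \<phi> x\<bar> \<le> C"
    by (rule bounded[OF 2]) (rule K0')
qed

lemma partial_deriv_translate:
  "partial_deriv j (\<lambda>x. \<phi> (x - v)) x = partial_deriv j \<phi> (x - v)"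
  by (simp add: partial_deriv_def algebra_simps)

lemma test_function_difference:
  fixes \<phi> :: "real^'n \<Rightarrow> real"
  assumes "\<phi> \<in> test_functions \<Omega>" "0 \<le> h"
  shows "\<phi> (x - h *\<^sub>R axis j 1) - \<phi> x =
    - (LINT t|lborel. indicator {0..h} t * partial_deriv j \<phi> (x - t *\<^sub>R axis j 1))"
proof -
  have "(LINT t|lborel. - partial_deriv j \<phi> (x - t *\<^sub>R axis j 1) * indicator {0..h} t) =
      \<phi> (x - h *\<^sub>R axis j 1) - \<phi> (x - 0 *\<^sub>R axis j 1)"
  proof (rule integral_FTC_Icc_real)
    fix t :: real
    have "((\<lambda>s. \<phi> (x + (- s) *\<^sub>R axis j 1)) has_real_derivative
        partial_deriv j \<phi> (x + (- t) *\<^sub>R axis j 1) * - 1) (at t)"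
      by (rule DERIV_chain2[OF test_function_DERIV[OF assms(1)]]) (auto intro!: derivative_eq_intros)
    then show "((\<lambda>s. \<phi> (x - s *\<^sub>R axis j 1)) has_real_derivative
        - partial_deriv j \<phi> (x - t *\<^sub>R axis j 1)) (at t)"
      by simp
    have "continuous_on UNIV (\<lambda>t. - partial_deriv j \<phi> (x - t *\<^sub>R axis j 1))"
      by (intro continuous_intros continuous_on_compose2[OF test_function_continuous_deriv[OF assms(1)]]) auto
    then show "isCont (\<lambda>t. - partial_deriv j \<phi> (x - t *\<^sub>R axis j 1)) t"
      by (simp add: continuous_on_eq_continuous_at)
  qed (use assms in auto)
  then show ?thesis by (simp add: mult.commute)
qed

lemma integrable_translates_along_interval:
  fixes g :: "'a::euclidean_space \<Rightarrow> real"
  assumes g: "integrable lborel g"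
  shows "integrable (lborel \<Otimes>\<^sub>M lborel) (\<lambda>(x, t). indicator {0..h} t * g (x + t *\<^sub>R e))"
proof -
  have [measurable]: "g \<in> borel_measurable borel"
    using g by auto
  have [simp]: "integrable lborel (indicator {0..h} :: real \<Rightarrow> real)"
    by (rule integrable_real_indicator) (auto simp: emeasure_lborel_Icc_eq)
  have "integrable (lborel \<Otimes>\<^sub>M lborel) (\<lambda>p. indicator {0..h} (fst p) * g (snd p + fst p *\<^sub>R e))"
  proof (rule lborel_pair.Fubini_integrable)
    have "(LINT y|lborel. norm (indicator {0..h} (fst (x, y)) * g (snd (x, y) + fst (x, y) *\<^sub>R e))) =
        indicator {0..h} x * (LINT y|lborel. \<bar>g y\<bar>)" for x
      using lborel_integral_translate[of "\<lambda>y. \<bar>g y\<bar>" "x *\<^sub>R e"]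
      by (simp add: abs_mult)
    then show "integrable lborel (\<lambda>x. LINT y|lborel. norm (indicator {0..h} (fst (x, y)) *
        g (snd (x, y) + fst (x, y) *\<^sub>R e)))"
      by simp
    show "AE x in lborel. integrable lborel (\<lambda>y. indicator {0..h} (fst (x, y)) *
        g (snd (x, y) + fst (x, y) *\<^sub>R e))"
      using lborel_integrable_translate[OF g] by simp
  qed measurable
  then show ?thesis
    by (subst lborel_pair.integrable_product_swap_iff[symmetric]) (simp add: split_beta')
qed

text \<open>Averaging test functions over translates is dual to averaging \<open>g\<close> along segments.\<close>
lemma integral_translates_swap:
  fixes g :: "'a::euclidean_space \<Rightarrow> real"
  assumes g: "integrable lborel g" and \<phi>: "\<phi> \<in> borel_measurable borel" "\<And>x. \<bar>\<phi> x\<bar> \<le> C"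
  shows "(LINT t|lborel. indicator {0..h} t * (LINT x|lborel. g x * \<phi> (x - t *\<^sub>R e))) =
    (LINT x|lborel. \<phi> x * (LINT t|lborel. indicator {0..h} t * g (x + t *\<^sub>R e)))"
proof -
  have [measurable]: "g \<in> borel_measurable borel" "\<phi> \<in> borel_measurable borel"
    using g \<phi> by auto
  have int: "integrable (lborel \<Otimes>\<^sub>M lborel) (\<lambda>(x, t). \<phi> x * (indicator {0..h} t * g (x + t *\<^sub>R e)))"
  proof (rule Bochner_Integration.integrable_bound)
    show "integrable (lborel \<Otimes>\<^sub>M lborel) (\<lambda>p. C * (\<lambda>(x, t). indicator {0..h} t * g (x + t *\<^sub>R e)) p)"
      by (intro integrable_mult_right integrable_translates_along_interval g)
    show "AE p in lborel \<Otimes>\<^sub>M lborel. norm ((\<lambda>(x, t). \<phi> x * (indicator {0..h} t * g (x + t *\<^sub>R e))) p)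
        \<le> norm (C * (\<lambda>(x, t). indicator {0..h} t * g (x + t *\<^sub>R e)) p)"
      using \<phi>(2) by (auto simp: abs_mult intro!: AE_I2 mult_right_mono order.trans[OF \<phi>(2) abs_ge_self])
  qed measurable
  have "(LINT x|lborel. g x * \<phi> (x - t *\<^sub>R e)) = (LINT x|lborel. g (x + t *\<^sub>R e) * \<phi> x)" for t
    using lborel_integral_translate[of "\<lambda>x. g x * \<phi> (x - t *\<^sub>R e)" "t *\<^sub>R e"] by simp
  then have "(LINT t|lborel. indicator {0..h} t * (LINT x|lborel. g x * \<phi> (x - t *\<^sub>R e))) =
      (LINT t|lborel. LINT x|lborel. \<phi> x * (indicator {0..h} t * g (x + t *\<^sub>R e)))"
    by (simp add: mult_ac flip: integral_mult_right_zero)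
  also have "\<dots> = (LINT x|lborel. LINT t|lborel. \<phi> x * (indicator {0..h} t * g (x + t *\<^sub>R e)))"
    by (rule lborel_pair.Fubini_integral[OF int])
  finally show ?thesis by simp
qed

text \<open>The fundamental theorem of calculus writes the difference of \<open>\<phi>\<close> as an integral of its partial
  derivative along a segment; Fubini's theorem exchanges the two integrations.\<close>
lemma integral_test_function_difference:
  fixes u :: "real^'n \<Rightarrow> real"
  assumes u: "integrable lborel u" and \<phi>: "\<phi> \<in> test_functions \<Omega>" and h: "0 \<le> h"
  shows "(LINT x|lborel. u x * (\<phi> (x - h *\<^sub>R axis j 1) - \<phi> x)) =
    - (LINT t|lborel. indicator {0..h} t * (LINT x|lborel. u x * partial_deriv j \<phi> (x - t *\<^sub>R axis j 1)))"
proof -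
  let ?d = "partial_deriv j \<phi>" and ?e = "axis j 1 :: real^'n"
  obtain C where C: "\<And>x. \<bar>?d x\<bar> \<le> C"
    using test_function_deriv_bounded[OF \<phi>] by blast
  have [measurable]: "u \<in> borel_measurable borel" "?d \<in> borel_measurable borel"
    using u test_function_continuous_deriv[OF \<phi>] by (auto intro: borel_measurable_continuous_onI)
  have [simp]: "integrable lborel (indicator {0..h} :: real \<Rightarrow> real)"
    by (rule integrable_real_indicator) (auto simp: emeasure_lborel_Icc_eq)
  have prod: "integrable (lborel \<Otimes>\<^sub>M lborel) (\<lambda>(x, t). u x * indicator {0..h} t)"
  proof (rule lborel_pair.Fubini_integrable)
    have "(\<lambda>x. LINT t|lborel. norm (case (x, t) of (x, t) \<Rightarrow> u x * indicator {0..h} t)) =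
        (\<lambda>x. \<bar>u x\<bar> * (LINT t|lborel. indicator {0..h} t))"
      by (simp add: abs_mult)
    then show "integrable lborel (\<lambda>x. LINT t|lborel. norm (case (x, t) of (x, t) \<Rightarrow> u x * indicator {0..h} t))"
      using u by simp
  qed auto
  have int: "integrable (lborel \<Otimes>\<^sub>M lborel) (\<lambda>(x, t). u x * (indicator {0..h} t * ?d (x - t *\<^sub>R ?e)))"
  proof (rule Bochner_Integration.integrable_bound)
    show "integrable (lborel \<Otimes>\<^sub>M lborel) (\<lambda>p. C * (\<lambda>(x, t). u x * indicator {0..h} t) p)"
      by (intro integrable_mult_right prod)
    show "AE p in lborel \<Otimes>\<^sub>M lborel. norm ((\<lambda>(x, t). u x * (indicator {0..h} t * ?d (x - t *\<^sub>R ?e))) p)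
        \<le> norm (C * (\<lambda>(x, t). u x * indicator {0..h} t) p)"
    proof (intro AE_I2, clarsimp simp: abs_mult indicator_def)
      fix x t
      show "\<bar>u x\<bar> * \<bar>?d (x - t *\<^sub>R ?e)\<bar> \<le> \<bar>C\<bar> * \<bar>u x\<bar>"
        using order.trans[OF C abs_ge_self] by (subst mult.commute) (intro mult_right_mono, auto)
    qed
  qed measurable
  have "(LINT x|lborel. u x * (\<phi> (x - h *\<^sub>R ?e) - \<phi> x)) =
      - (LINT x|lborel. LINT t|lborel. u x * (indicator {0..h} t * ?d (x - t *\<^sub>R ?e)))"
    by (simp add: test_function_difference[OF \<phi> h])
  also have "(LINT x|lborel. LINT t|lborel. u x * (indicator {0..h} t * ?d (x - t *\<^sub>R ?e))) =
      (LINT t|lborel. LINT x|lborel. u x * (indicator {0..h} t * ?d (x - t *\<^sub>R ?e)))"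
    by (rule lborel_pair.Fubini_integral[OF int, symmetric])
  also have "\<dots> = (LINT t|lborel. indicator {0..h} t * (LINT x|lborel. u x * ?d (x - t *\<^sub>R ?e)))"
    by (simp add: mult.left_commute[of "u _"])
  finally show ?thesis .
qed

text \<open>Both sides have the same integral against every bump \<open>\<phi>\<close> on a box inside \<open>box p q\<close>: moving the
  translation onto \<open>\<phi>\<close>, the left-hand side becomes a difference of \<open>\<phi>\<close>, hence an average of
  derivatives of translates of \<open>\<phi>\<close>.  These are still test functions on \<open>\<Omega>\<close>, so the weak
  derivative applies to each of them.\<close>
lemma AE_difference_eq_line_integral:
  fixes u g :: "real^'n \<Rightarrow> real"
  assumes u: "integrable lborel u" and g: "integrable lborel g"
    and weak: "\<And>\<phi>. \<phi> \<in> test_functions \<Omega> \<Longrightarrow>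
        (LINT x|lborel. u x * partial_deriv j \<phi> x) = - (LINT x|lborel. g x * \<phi> x)"
    and h: "0 \<le> h"
    and inside: "\<And>x t. x \<in> cbox p q \<Longrightarrow> t \<in> {0..h} \<Longrightarrow> x + t *\<^sub>R axis j 1 \<in> \<Omega>"
  shows "AE x in lborel. x \<in> box p q \<longrightarrow>
    u (x + h *\<^sub>R axis j 1) - u x = (LINT t|lborel. indicator {0..h} t * g (x + t *\<^sub>R axis j 1))"
proof -
  let ?e = "axis j 1 :: real^'n"
  define I where "I x = (LINT t|lborel. indicator {0..h} t * g (x + t *\<^sub>R ?e))" for x
  have I: "integrable lborel I"
    unfolding I_def by (rule lborel_pair.integrable_fst[OF integrable_translates_along_interval[OF g]])
  have uh: "integrable lborel (\<lambda>x. u (x + h *\<^sub>R ?e))"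
    by (rule lborel_integrable_translate[OF u])
  have [measurable]: "u \<in> borel_measurable borel" "I \<in> borel_measurable borel"
    using u I by auto
  have "AE x in lborel. x \<in> box p q \<longrightarrow> u (x + h *\<^sub>R ?e) - u x - I x = 0"
  proof (rule AE_zero_if_integral_box_bumps_zero)
    show "integrable lborel (\<lambda>x. u (x + h *\<^sub>R ?e) - u x - I x)"
      using uh u I by simp
    fix c a b
    assume c: "(0::real) < c" and ab: "cbox a b \<subseteq> cbox p q"
    define \<phi> where "\<phi> = box_bump c a b"
    have test: "(\<lambda>x. \<phi> (x - t *\<^sub>R ?e)) \<in> test_functions \<Omega>" if "t \<in> {0..h}" for t
    proof -
      have "cbox (a + t *\<^sub>R ?e) (b + t *\<^sub>R ?e) \<subseteq> \<Omega>"
      proof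
        fix x
        assume "x \<in> cbox (a + t *\<^sub>R ?e) (b + t *\<^sub>R ?e)"
        then have "x - t *\<^sub>R ?e \<in> cbox a b"
          by (simp add: mem_box_cart algebra_simps)
        with ab inside[of "x - t *\<^sub>R ?e" t] that show "x \<in> \<Omega>" by auto
      qed
      then show ?thesis
        unfolding \<phi>_def box_bump_translate using c by (intro box_bump_test_function)
    qed
    have \<phi>: "\<phi> \<in> test_functions \<Omega>"
      using test[of 0] h by simp
    then have [measurable]: "\<phi> \<in> borel_measurable borel"
      by (intro borel_measurable_continuous_onI test_function_continuous)
    have b: "\<bar>\<phi> x\<bar> \<le> 1" for x
      using box_bump_bounds[of c a b x] c by (simp add: \<phi>_def)
    have int: "integrable lborel (\<lambda>x. f x * \<phi> (x - v))" if "integrable lborel f" for f v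
      by (rule Bochner_Integration.integrable_bound[OF that])
        (use that b in \<open>auto simp: abs_mult intro!: mult_left_le\<close>)
    have "(LINT x|lborel. u x * \<phi> (x - h *\<^sub>R ?e)) = (LINT x|lborel. u (x + h *\<^sub>R ?e) * \<phi> x)"
      using lborel_integral_translate[of "\<lambda>x. u x * \<phi> (x - h *\<^sub>R ?e)" "h *\<^sub>R ?e"] by simp
    then have "(LINT x|lborel. \<phi> x * (u (x + h *\<^sub>R ?e) - u x - I x)) =
        (LINT x|lborel. u x * (\<phi> (x - h *\<^sub>R ?e) - \<phi> x)) - (LINT x|lborel. \<phi> x * I x)"
      using int[OF u, of "h *\<^sub>R ?e"] int[OF u, of 0] int[OF I, of 0] int[OF uh, of 0]
      by (simp add: algebra_simps)
    also have "(LINT x|lborel. u x * (\<phi> (x - h *\<^sub>R ?e) - \<phi> x)) =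
        - (LINT t|lborel. indicator {0..h} t * (LINT x|lborel. u x * partial_deriv j \<phi> (x - t *\<^sub>R ?e)))"
      by (rule integral_test_function_difference[OF u \<phi> h])
    also have "\<dots> = (LINT t|lborel. indicator {0..h} t * (LINT x|lborel. g x * \<phi> (x - t *\<^sub>R ?e)))"
      unfolding integral_minus[symmetric]
      by (rule Bochner_Integration.integral_cong)
        (auto simp: indicator_def weak[OF test] simp flip: partial_deriv_translate)
    also have "\<dots> = (LINT x|lborel. \<phi> x * I x)"
      unfolding I_def by (rule integral_translates_swap[OF g _ b]) simp
    finally show "(LINT x|lborel. box_bump c a b x * (u (x + h *\<^sub>R ?e) - u x - I x)) = 0"
      by (simp add: \<phi>_def)
  qed
  then show ?thesis
    by eventually_elim (simp add: I_def)
qed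

section \<open>Continuity of translations in the mean\<close>

lemma L1_translation_null_if_approximable:
  fixes a :: "'a::euclidean_space \<Rightarrow> real" and s :: "nat \<Rightarrow> 'a"
  assumes a: "integrable lborel a"
    and approx: "\<And>\<epsilon>. \<epsilon> > 0 \<Longrightarrow> \<exists>b. integrable lborel b \<and> (LINT x|lborel. \<bar>a x - b x\<bar>) \<le> \<epsilon> \<and>
        (\<lambda>k. LINT x|lborel. \<bar>b (x + s k) - b x\<bar>) \<longlonglongrightarrow> 0"
  shows "(\<lambda>k. LINT x|lborel. \<bar>a (x + s k) - a x\<bar>) \<longlonglongrightarrow> 0"
proof (rule LIMSEQ_I)
  fix r :: real
  assume "r > 0"
  then obtain b where b: "integrable lborel b" "(LINT x|lborel. \<bar>a x - b x\<bar>) \<le> r / 3"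
      "(\<lambda>k. LINT x|lborel. \<bar>b (x + s k) - b x\<bar>) \<longlonglongrightarrow> 0"
    using approx[of "r / 3"] by auto
  have le: "(LINT x|lborel. \<bar>a (x + v) - a x\<bar>) \<le> 2 * (r / 3) + (LINT x|lborel. \<bar>b (x + v) - b x\<bar>)" for v
  proof -
    note tr = lborel_integrable_translate[OF a, of v] lborel_integrable_translate[OF b(1), of v]
    have "(\<lambda>x. \<bar>a x - b x\<bar>) \<in> borel_measurable borel"
      using a b(1) by auto
    from lborel_integral_translate[OF this, of v]
    have eq: "(LINT x|lborel. \<bar>a (x + v) - b (x + v)\<bar>) = (LINT x|lborel. \<bar>a x - b x\<bar>)" .
    have "(LINT x|lborel. \<bar>a (x + v) - a x\<bar>) \<le>
        (LINT x|lborel. \<bar>a (x + v) - b (x + v)\<bar> + \<bar>b (x + v) - b x\<bar> + \<bar>a x - b x\<bar>)"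
      using a b(1) tr by (intro integral_mono) auto
    also have "\<dots> = (LINT x|lborel. \<bar>a (x + v) - b (x + v)\<bar>) + (LINT x|lborel. \<bar>b (x + v) - b x\<bar>) +
        (LINT x|lborel. \<bar>a x - b x\<bar>)"
      using a b(1) tr by simp
    finally show ?thesis
      using b(2) eq by linarith
  qed
  obtain k0 where k0: "\<And>k. k \<ge> k0 \<Longrightarrow> (LINT x|lborel. \<bar>b (x + s k) - b x\<bar>) < r / 3"
    using LIMSEQ_D[OF b(3), of "r / 3"] \<open>r > 0\<close> by auto
  have "norm ((LINT x|lborel. \<bar>a (x + s k) - a x\<bar>) - 0) < r" if "k \<ge> k0" for k
    using le[of "s k"] k0[OF that] by simp
  then show "\<exists>no. \<forall>n\<ge>no. norm ((LINT x|lborel. \<bar>a (x + s n) - a x\<bar>) - 0) < r"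
    by blast
qed

text \<open>Openness of \<open>U\<close> gives pointwise convergence where it is needed: a point of \<open>U\<close> stays in \<open>U\<close>
  under small translations.  The part entering \<open>U\<close> has the same measure as the part leaving it,
  so only the latter has to be estimated; this avoids any condition on the boundary of \<open>U\<close>.\<close>
lemma L1_translation_null_open:
  fixes U :: "'a::euclidean_space set"
  assumes U: "open U" "emeasure lborel U < \<infinity>" and s: "s \<longlonglongrightarrow> 0"
  shows "(\<lambda>k. LINT x|lborel. \<bar>indicator U (x + s k) - indicator U x :: real\<bar>) \<longlonglongrightarrow> 0"
proof -
  have [measurable]: "U \<in> sets borel" using U by auto
  have ind: "integrable lborel (indicator U :: 'a \<Rightarrow> real)"
    using U by (intro integrable_real_indicator) auto
  let ?d = "\<lambda>k x. indicator U x * (1 - indicator U (x + s k)) :: real"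
  have d: "integrable lborel (?d k)" for k
    by (rule Bochner_Integration.integrable_bound[OF ind]) (auto simp: indicator_def)
  have "(\<lambda>k. LINT x|lborel. ?d k x) \<longlonglongrightarrow> (LINT x|(lborel :: 'a measure). 0)"
  proof (rule integral_dominated_convergence[where w="indicator U"])
    have "(\<lambda>k. ?d k x) \<longlonglongrightarrow> 0" for x
    proof (cases "x \<in> U")
      case True
      have "(\<lambda>k. x + s k) \<longlonglongrightarrow> x + 0"
        by (intro tendsto_intros s)
      then have "eventually (\<lambda>k. x + s k \<in> U) sequentially"
        using U(1) True by (intro topological_tendstoD) auto
      then have "eventually (\<lambda>k. 0 = ?d k x) sequentially"
        by eventually_elim simp
      then show ?thesis
        by (rule Lim_transform_eventually[OF tendsto_const])
    qed simp
    then show "AE x in lborel. (\<lambda>k. ?d k x) \<longlonglongrightarrow> 0" by simp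
  qed (use ind in \<open>auto simp: indicator_def\<close>)
  moreover have "(LINT x|lborel. \<bar>indicator U (x + s k) - indicator U x :: real\<bar>) = 2 * (LINT x|lborel. ?d k x)" for k
  proof -
    \<comment> \<open>For numbers a and b in {0, 1}, the distance of a and b is a - b + 2 b (1 - a).\<close>
    have "(LINT x|lborel. \<bar>indicator U (x + s k) - indicator U x :: real\<bar>) =
        (LINT x|lborel. indicator U (x + s k) - indicator U x + 2 * ?d k x)"
      by (rule Bochner_Integration.integral_cong) (auto simp: indicator_def)
    also have "\<dots> = (LINT x|lborel. indicator U (x + s k)) - (LINT x|lborel. indicator U x) + 2 * (LINT x|lborel. ?d k x)"
      using ind d[of k] lborel_integrable_translate[OF ind, of "s k"] by simp
    also have "(LINT x|lborel. indicator U (x + s k) :: real) = (LINT x|lborel. indicator U x)"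
      by (rule lborel_integral_translate) simp
    finally show ?thesis by simp
  qed
  ultimately show ?thesis
    using tendsto_mult_right_zero[of _ _ 2] by simp
qed

lemma L1_translation_null:
  fixes a :: "'a::euclidean_space \<Rightarrow> real"
  assumes a: "integrable lborel a" and s: "s \<longlonglongrightarrow> 0"
  shows "(\<lambda>k. LINT x|lborel. \<bar>a (x + s k) - a x\<bar>) \<longlonglongrightarrow> 0"
  using a
proof (induction a rule: integrable_induct)
  case (base A c)
  then have [measurable]: "A \<in> sets borel" by simp
  have ind: "integrable lborel (indicator A :: 'a \<Rightarrow> real)"
    using base by (intro integrable_real_indicator) auto
  have "(\<lambda>k. LINT x|lborel. \<bar>indicator A (x + s k) - indicator A x :: real\<bar>) \<longlonglongrightarrow> 0"
  proof (rule L1_translation_null_if_approximable[OF ind])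
    fix \<epsilon> :: real
    assume "\<epsilon> > 0"
    then obtain U where U: "open U" "A \<subseteq> U" "emeasure lborel (U - A) < \<epsilon>"
      using outer_regular_lborel[of A \<epsilon>] by auto
    then have [measurable]: "U \<in> sets borel" by auto
    have "emeasure lborel U \<le> emeasure lborel A + emeasure lborel (U - A)"
      using U(2) by (subst plus_emeasure) (auto intro!: emeasure_mono)
    also have "\<dots> < \<infinity>"
      using base U(3) by (auto simp: less_top[symmetric] dest: order.strict_trans[OF _ ennreal_less_top])
    finally have fin: "emeasure lborel U < \<infinity>" .
    have "(LINT x|lborel. \<bar>indicator A x - indicator U x :: real\<bar>) = (LINT x|lborel. indicator (U - A) x)"
      using U(2) by (intro Bochner_Integration.integral_cong) (auto simp: indicator_def)
    also have "\<dots> = measure lborel (U - A)" by simp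
    also have "\<dots> \<le> \<epsilon>"
      using U(3) \<open>\<epsilon> > 0\<close> by (simp add: measure_def enn2real_leI)
    finally show "\<exists>b. integrable lborel b \<and> (LINT x|lborel. \<bar>indicator A x - b x\<bar>) \<le> \<epsilon> \<and>
        (\<lambda>k. LINT x|lborel. \<bar>b (x + s k) - b x\<bar>) \<longlonglongrightarrow> 0"
      using L1_translation_null_open[OF U(1) fin s] fin
      by (intro exI[of _ "indicator U"]) auto
  qed
  moreover have "(LINT x|lborel. \<bar>indicator A (x + v) *\<^sub>R c - indicator A x *\<^sub>R c\<bar>) =
      \<bar>c\<bar> * (LINT x|lborel. \<bar>indicator A (x + v) - indicator A x\<bar>)" for v
    by (subst integral_mult_right_zero[symmetric])
      (simp add: abs_mult[symmetric] right_diff_distrib mult.commute)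
  ultimately show ?case
    using tendsto_mult_right_zero[of _ _ "\<bar>c\<bar>"] by simp
next
  case (add f g)
  show ?case
  proof (rule tendsto_sandwich[of "\<lambda>_. 0"])
    show "(\<lambda>k. (LINT x|lborel. \<bar>f (x + s k) - f x\<bar>) + (LINT x|lborel. \<bar>g (x + s k) - g x\<bar>)) \<longlonglongrightarrow> 0"
      using tendsto_add[OF add(3,4)] by simp
    have "(LINT x|lborel. \<bar>f (x + v) + g (x + v) - (f x + g x)\<bar>) \<le>
        (LINT x|lborel. \<bar>f (x + v) - f x\<bar>) + (LINT x|lborel. \<bar>g (x + v) - g x\<bar>)" for v
    proof -
      have df: "integrable lborel (\<lambda>x. f (x + v) - f x)" and dg: "integrable lborel (\<lambda>x. g (x + v) - g x)"
        by (intro Bochner_Integration.integrable_diff lborel_integrable_translate add(1,2))+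
      have "integrable lborel (\<lambda>x. f (x + v) + g (x + v) - (f x + g x))"
        using Bochner_Integration.integrable_add[OF df dg] by (simp add: algebra_simps)
      then have "(LINT x|lborel. \<bar>f (x + v) + g (x + v) - (f x + g x)\<bar>) \<le>
          (LINT x|lborel. \<bar>f (x + v) - f x\<bar> + \<bar>g (x + v) - g x\<bar>)"
        using df dg by (intro integral_mono integrable_abs Bochner_Integration.integrable_add) linarith+
      also have "\<dots> = (LINT x|lborel. \<bar>f (x + v) - f x\<bar>) + (LINT x|lborel. \<bar>g (x + v) - g x\<bar>)"
        using df dg by (intro Bochner_Integration.integral_add integrable_abs)
      finally show ?thesis .
    qed
    then show "\<forall>\<^sub>F k in sequentially. (LINT x|lborel. \<bar>f (x + s k) + g (x + s k) - (f x + g x)\<bar>) \<le>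
        (LINT x|lborel. \<bar>f (x + s k) - f x\<bar>) + (LINT x|lborel. \<bar>g (x + s k) - g x\<bar>)"
      by simp
  qed auto
next
  case (lim f t)
  show ?case
  proof (rule L1_translation_null_if_approximable[OF lim(4)])
    fix \<epsilon> :: real
    assume "\<epsilon> > 0"
    have [measurable]: "f \<in> borel_measurable borel" "t i \<in> borel_measurable borel" for i
      using lim(4) lim(1)[of i] by auto
    have "(\<lambda>i. LINT x|lborel. \<bar>f x - t i x\<bar>) \<longlonglongrightarrow> (LINT x|(lborel :: 'a measure). 0)"
    proof (rule integral_dominated_convergence[where w="\<lambda>x. 3 * \<bar>f x\<bar>"])
      have "(\<lambda>i. \<bar>f x - t i x\<bar>) \<longlonglongrightarrow> \<bar>f x - f x\<bar>" for x
        using lim(2) by (intro tendsto_intros) simp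
      then show "AE x in lborel. (\<lambda>i. \<bar>f x - t i x\<bar>) \<longlonglongrightarrow> 0" by simp
      show "AE x in lborel. norm \<bar>f x - t i x\<bar> \<le> 3 * \<bar>f x\<bar>" for i
      proof (rule AE_I2)
        fix x
        show "norm \<bar>f x - t i x\<bar> \<le> 3 * \<bar>f x\<bar>"
          using lim(3)[of x i] by simp
      qed
    qed (use lim(4) in auto)
    then have "eventually (\<lambda>i. (LINT x|lborel. \<bar>f x - t i x\<bar>) < \<epsilon>) sequentially"
      using \<open>\<epsilon> > 0\<close> by (intro order_tendstoD) auto
    then obtain i where "(LINT x|lborel. \<bar>f x - t i x\<bar>) < \<epsilon>"
      by (auto simp: eventually_sequentially)
    then show "\<exists>b. integrable lborel b \<and> (LINT x|lborel. \<bar>f x - b x\<bar>) \<le> \<epsilon> \<and>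
        (\<lambda>k. LINT x|lborel. \<bar>b (x + s k) - b x\<bar>) \<longlonglongrightarrow> 0"
      using lim(1,5) by (intro exI[of _ "t i"]) auto
  qed
qed

text \<open>Here the supremum over \<open>i\<close> is the norm of \<open>\<ell>\<^sup>\<infinity>\<close>, written out in coordinates.  For functions of
  finite rank the claim reduces to finitely many scalar functions \<open>a b\<close>; the error of the
  approximation is invariant under translations.\<close>
lemma L1_sup_translation_null:
  fixes G :: "nat \<Rightarrow> 'a::euclidean_space \<Rightarrow> real" and v :: "'b \<Rightarrow> nat \<Rightarrow> real"
  assumes G[measurable]: "\<And>i. G i \<in> borel_measurable borel" and s: "s \<longlonglongrightarrow> 0"
    and v: "\<And>b i. \<bar>v b i\<bar> \<le> B b"
    and approx: "\<And>\<epsilon>::real. \<epsilon> > (0::real) \<Longrightarrow> \<exists>S a. finite S \<and> (\<forall>b\<in>S. integrable lborel (a b)) \<and>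
        (\<integral>\<^sup>+x. (SUP i. ennreal \<bar>G i x - (\<Sum>b\<in>S. v b i * a b x)\<bar>) \<partial>lborel) \<le> \<epsilon>"
  shows "(\<lambda>k. \<integral>\<^sup>+x. (SUP i. ennreal \<bar>G i (x + s k) - G i x\<bar>) \<partial>lborel) \<longlonglongrightarrow> 0"
proof (rule tendsto_zero_ennreal)
  fix r :: real
  assume "r > 0"
  then obtain S a where S: "finite S" "\<And>b. b \<in> S \<Longrightarrow> integrable lborel (a b)"
    and le: "(\<integral>\<^sup>+x. (SUP i. ennreal \<bar>G i x - (\<Sum>b\<in>S. v b i * a b x)\<bar>) \<partial>lborel) \<le> ennreal (r / 4)"
    using approx[of "r / 4"] by auto
  define E where "E x = (SUP i. ennreal \<bar>G i x - (\<Sum>b\<in>S. v b i * a b x)\<bar>)" for x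
  have [measurable]: "\<And>b. b \<in> S \<Longrightarrow> a b \<in> borel_measurable borel"
    using S(2) by auto
  have [measurable]: "E \<in> borel_measurable borel"
    unfolding E_def by measurable
  define L where "L w = (\<Sum>b\<in>S. B b * (LINT x|lborel. \<bar>a b (x + w) - a b x\<bar>))" for w
  have B: "0 \<le> B b" for b
    using v[of b 0] by linarith
  have "(\<lambda>k. L (s k)) \<longlonglongrightarrow> (\<Sum>b\<in>S. B b * 0)"
    unfolding L_def by (intro tendsto_intros L1_translation_null S(2) s)
  then have "eventually (\<lambda>k. L (s k) < r / 4) sequentially"
    using \<open>r > 0\<close> by (intro order_tendstoD) auto
  then show "\<forall>\<^sub>F k in sequentially. (\<integral>\<^sup>+x. (SUP i. ennreal \<bar>G i (x + s k) - G i x\<bar>) \<partial>lborel) < ennreal r"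
  proof eventually_elim
    case (elim k)
    let ?w = "s k"
    have pt: "(SUP i. ennreal \<bar>G i (x + ?w) - G i x\<bar>) \<le>
        E (x + ?w) + E x + ennreal (\<Sum>b\<in>S. B b * \<bar>a b (x + ?w) - a b x\<bar>)" for x
    proof (rule SUP_least)
      fix i
      let ?R = "\<lambda>x. \<Sum>b\<in>S. v b i * a b x"
      have "\<bar>?R (x + ?w) - ?R x\<bar> \<le> (\<Sum>b\<in>S. \<bar>v b i * (a b (x + ?w) - a b x)\<bar>)"
        by (simp add: sum_subtractf[symmetric] right_diff_distrib[symmetric] del: sum_subtractf)
      also have "\<dots> \<le> (\<Sum>b\<in>S. B b * \<bar>a b (x + ?w) - a b x\<bar>)"
        by (intro sum_mono) (simp add: abs_mult mult_right_mono v)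
      finally have "\<bar>G i (x + ?w) - G i x\<bar> \<le> \<bar>G i (x + ?w) - ?R (x + ?w)\<bar> + \<bar>G i x - ?R x\<bar> +
          (\<Sum>b\<in>S. B b * \<bar>a b (x + ?w) - a b x\<bar>)"
        by linarith
      then have "ennreal \<bar>G i (x + ?w) - G i x\<bar> \<le> ennreal \<bar>G i (x + ?w) - ?R (x + ?w)\<bar> +
          ennreal \<bar>G i x - ?R x\<bar> + ennreal (\<Sum>b\<in>S. B b * \<bar>a b (x + ?w) - a b x\<bar>)"
        using B by (auto simp: sum_nonneg intro!: ennreal_leI simp flip: ennreal_plus)
      also have "\<dots> \<le> E (x + ?w) + E x + ennreal (\<Sum>b\<in>S. B b * \<bar>a b (x + ?w) - a b x\<bar>)"
        unfolding E_def by (intro add_mono order_refl SUP_upper) auto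
      finally show "ennreal \<bar>G i (x + ?w) - G i x\<bar> \<le> \<dots>" .
    qed
    have int: "integrable lborel (\<lambda>x. \<bar>a b (x + ?w) - a b x\<bar>)" if "b \<in> S" for b
      using S(2)[OF that] lborel_integrable_translate[OF S(2)[OF that]] by auto
    have "(\<integral>\<^sup>+x. (SUP i. ennreal \<bar>G i (x + ?w) - G i x\<bar>) \<partial>lborel) \<le>
        (\<integral>\<^sup>+x. E (x + ?w) + E x + ennreal (\<Sum>b\<in>S. B b * \<bar>a b (x + ?w) - a b x\<bar>) \<partial>lborel)"
      by (intro nn_integral_mono pt)
    also have "\<dots> = (\<integral>\<^sup>+x. E (x + ?w) \<partial>lborel) + (\<integral>\<^sup>+x. E x \<partial>lborel) +
        (\<integral>\<^sup>+x. ennreal (\<Sum>b\<in>S. B b * \<bar>a b (x + ?w) - a b x\<bar>) \<partial>lborel)"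
      by (simp add: nn_integral_add)
    also have "(\<integral>\<^sup>+x. E (x + ?w) \<partial>lborel) = (\<integral>\<^sup>+x. E x \<partial>lborel)"
      by (rule lborel_nn_integral_translate) simp
    also have "(\<integral>\<^sup>+x. ennreal (\<Sum>b\<in>S. B b * \<bar>a b (x + ?w) - a b x\<bar>) \<partial>lborel) = ennreal (L ?w)"
      unfolding L_def using int B
      by (subst nn_integral_eq_integral) (auto intro!: AE_I2 sum_nonneg)
    also have "(\<integral>\<^sup>+x. E x \<partial>lborel) + (\<integral>\<^sup>+x. E x \<partial>lborel) + ennreal (L ?w) \<le>
        ennreal (r / 4) + ennreal (r / 4) + ennreal (r / 4)"
      using le elim by (intro add_mono) (auto simp: E_def intro!: ennreal_leI)
    also have "\<dots> = ennreal (3 * r / 4)"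
      using \<open>r > 0\<close> by (simp flip: ennreal_plus)
    also have "\<dots> < ennreal r"
      using \<open>r > 0\<close> by (intro ennreal_lessI) auto
    finally show ?case .
  qed
qed

section \<open>Bochner integrals in \<open>\<ell>\<^sup>\<infinity>\<close> and their coordinates\<close>

lemma bounded_linear_apply_bcontfun: "bounded_linear (\<lambda>f :: linf. apply_bcontfun f i)"
  by (rule bounded_linear_intro[where K=1]) (simp_all add: norm_bounded flip: real_norm_def)

text \<open>In a nonseparable space the difference of two measurable functions need not be measurable.
  It is enough here that one of them takes finitely many values, each on a measurable set.\<close>
lemma borel_measurable_norm_diff_simple_function:
  fixes F :: "'a \<Rightarrow> 'b::real_normed_vector"
  assumes F: "F \<in> borel_measurable M" and s: "simple_function M s"
  shows "(\<lambda>x. norm (F x - s x)) \<in> borel_measurable M"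
proof (rule measurable_piecewise_restrict)
  let ?C = "(\<lambda>y. s -` {y} \<inter> space M) ` s ` space M"
  show "countable ?C"
    by (intro countable_finite finite_imageI simple_functionD(1)[OF s])
  show "space M \<subseteq> \<Union>?C"
    by auto
  fix A
  assume "A \<in> ?C"
  then obtain y where A: "A = s -` {y} \<inter> space M"
    by auto
  then show "A \<inter> space M \<in> sets M"
    using simple_functionD(2)[OF s, of "{y}"] by simp
  have "(\<lambda>x. norm (F x - y)) \<in> borel_measurable M"
    by (intro measurable_compose[OF F] borel_measurable_continuous_onI continuous_intros)
  then have "(\<lambda>x. norm (F x - y)) \<in> borel_measurable (restrict_space M A)"
    by (rule measurable_restrict_space1)
  then show "(\<lambda>x. norm (F x - s x)) \<in> borel_measurable (restrict_space M A)"
    by (rule measurable_cong[THEN iffD1, rotated]) (auto simp: A space_restrict_space)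
qed

lemma has_bochner_int_bounded_linear:
  fixes F :: "'a \<Rightarrow> 'b::real_normed_vector" and T :: "'b \<Rightarrow> 'c::{real_normed_vector, second_countable_topology}"
  assumes "has_bochner_int M F v" "bounded_linear T"
  shows "has_bochner_integral M (\<lambda>x. T (F x)) (T v)"
proof -
  interpret T: bounded_linear T by fact
  obtain s where F: "F \<in> borel_measurable M" and s: "\<And>i. Bochner_Integration.simple_bochner_integrable M (s i)"
    and lim: "(\<lambda>i. \<integral>\<^sup>+x. ennreal (norm (F x - s i x)) \<partial>M) \<longlonglongrightarrow> 0"
    and int: "(\<lambda>i. Bochner_Integration.simple_bochner_integral M (s i)) \<longlonglongrightarrow> v"
    using assms(1) unfolding has_bochner_int_def by blast
  show ?thesis
  proof (rule has_bochner_integral.intros)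
    show "(\<lambda>x. T (F x)) \<in> borel_measurable M"
      by (intro measurable_compose[OF F] borel_measurable_continuous_onI T.continuous_on continuous_on_id)
    show "Bochner_Integration.simple_bochner_integrable M (\<lambda>x. T (s i x))" for i
      by (rule simple_bochner_integrable_compose2[of "\<lambda>x y. T x", OF T.zero s s])
    show "(\<lambda>i. Bochner_Integration.simple_bochner_integral M (\<lambda>x. T (s i x))) \<longlonglongrightarrow> T v"
      using T.tendsto[OF int] by (simp add: simple_bochner_integral_linear[OF T.linear_axioms s])
    obtain K where K: "K > 0" "\<And>x. norm (T x) \<le> norm x * K"
      using T.pos_bounded by blast
    have "(\<lambda>i. ennreal K * (\<integral>\<^sup>+x. ennreal (norm (F x - s i x)) \<partial>M)) \<longlonglongrightarrow> ennreal K * 0"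
      by (intro tendsto_mult_ennreal tendsto_const lim) auto
    then have upper: "(\<lambda>i. ennreal K * (\<integral>\<^sup>+x. ennreal (norm (F x - s i x)) \<partial>M)) \<longlonglongrightarrow> 0"
      by simp
    have "(\<integral>\<^sup>+x. ennreal (norm (T (F x) - T (s i x))) \<partial>M) \<le>
        ennreal K * (\<integral>\<^sup>+x. ennreal (norm (F x - s i x)) \<partial>M)" for i
    proof -
      have "(\<lambda>x. ennreal (norm (F x - s i x))) \<in> borel_measurable M"
        by (rule measurable_compose[OF borel_measurable_norm_diff_simple_function[OF F] measurable_ennreal])
          (use s[of i] in \<open>auto elim: simple_bochner_integrable.cases\<close>)
      then have "ennreal K * (\<integral>\<^sup>+x. ennreal (norm (F x - s i x)) \<partial>M) =
          (\<integral>\<^sup>+x. ennreal K * ennreal (norm (F x - s i x)) \<partial>M)"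
        by (simp add: nn_integral_cmult)
      also have "\<dots> \<ge> (\<integral>\<^sup>+x. ennreal (norm (T (F x) - T (s i x))) \<partial>M)"
        using K by (intro nn_integral_mono) (simp add: T.diff[symmetric] mult.commute flip: ennreal_mult'')
      finally show ?thesis .
    qed
    then show "(\<lambda>i. \<integral>\<^sup>+x. ennreal (norm (T (F x) - T (s i x))) \<partial>M) \<longlonglongrightarrow> 0"
      by (intro tendsto_sandwich[OF always_eventually always_eventually tendsto_const upper] allI zero_le)
  qed
qed

lemma has_bochner_int_scaleR_left:
  fixes a :: "'a \<Rightarrow> real" and c :: "'b::real_normed_vector"
  assumes "has_bochner_integral M a r"
  shows "has_bochner_int M (\<lambda>x. a x *\<^sub>R c) (r *\<^sub>R c)"
proof -
  obtain s where a: "a \<in> borel_measurable M" and s: "\<And>i. Bochner_Integration.simple_bochner_integrable M (s i)"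
    and lim: "(\<lambda>i. \<integral>\<^sup>+x. ennreal (norm (a x - s i x)) \<partial>M) \<longlonglongrightarrow> 0"
    and int: "(\<lambda>i. Bochner_Integration.simple_bochner_integral M (s i)) \<longlonglongrightarrow> r"
    using assms unfolding has_bochner_integral.simps by blast
  have [measurable]: "a \<in> borel_measurable M" "s i \<in> borel_measurable M" for i
    using a s by (auto intro: borel_measurable_simple_function elim: simple_bochner_integrable.cases)
  interpret T: bounded_linear "\<lambda>t. t *\<^sub>R c" by (rule bounded_linear_scaleR_left)
  show ?thesis
    unfolding has_bochner_int_def
  proof (intro conjI exI allI)
    show "(\<lambda>x. a x *\<^sub>R c) \<in> borel_measurable M"
      by (intro measurable_compose[OF a] borel_measurable_continuous_onI continuous_intros)
    show "Bochner_Integration.simple_bochner_integrable M (\<lambda>x. s i x *\<^sub>R c)" for i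
      by (rule simple_bochner_integrable_compose2[of "\<lambda>x y. x *\<^sub>R c", OF T.zero s s])
    show "(\<lambda>i. Bochner_Integration.simple_bochner_integral M (\<lambda>x. s i x *\<^sub>R c)) \<longlonglongrightarrow> r *\<^sub>R c"
      using T.tendsto[OF int] by (simp add: simple_bochner_integral_linear[OF T.linear_axioms s])
    have "(\<lambda>i. (\<integral>\<^sup>+x. ennreal (norm (a x - s i x)) \<partial>M) * ennreal (norm c)) \<longlonglongrightarrow> 0 * ennreal (norm c)"
      by (intro tendsto_mult_ennreal tendsto_const lim) auto
    then show "(\<lambda>i. \<integral>\<^sup>+x. ennreal (norm (a x *\<^sub>R c - s i x *\<^sub>R c)) \<partial>M) \<longlonglongrightarrow> 0"
      by (simp add: scaleR_diff_left[symmetric] ennreal_mult nn_integral_multc)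
  qed
qed

text \<open>Passing to a Borel function, extended by \<open>0\<close>, makes translations and Fubini's theorem available:
  compositions with addition are in general not measurable for the product of the Lebesgue
  \<open>\<sigma>\<close>-algebras.\<close>
lemma borel_version_on:
  fixes w :: "'a::euclidean_space \<Rightarrow> real"
  assumes "w \<in> borel_measurable (lebesgue_on \<Omega>)" "\<Omega> \<in> sets lebesgue"
  shows "\<exists>w' \<in> borel_measurable borel. AE x in lborel. w' x = indicator \<Omega> x * w x"
proof -
  have "(\<lambda>x. indicator \<Omega> x * w x) \<in> borel_measurable lebesgue"
    using assms borel_measurable_restrict_space_iff[of \<Omega> lebesgue w] by simp
  from completion_ex_borel_measurable_real[OF this] show ?thesis
    by (auto simp: eq_commute)
qed

lemma borel_version_integral:
  fixes w :: "'a::euclidean_space \<Rightarrow> real"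
  assumes w: "w \<in> borel_measurable (lebesgue_on \<Omega>)" and \<Omega>: "\<Omega> \<in> sets lebesgue"
    and w'[measurable]: "w' \<in> borel_measurable borel" and eq: "AE x in lborel. w' x = indicator \<Omega> x * w x"
  shows borel_version_integrable_iff: "integrable (lebesgue_on \<Omega>) w \<longleftrightarrow> integrable lborel w'"
    and borel_version_integral_eq: "integral\<^sup>L (lebesgue_on \<Omega>) w = (LINT x|lborel. w' x)"
proof -
  have m: "(\<lambda>x. indicator \<Omega> x * w x) \<in> borel_measurable lebesgue"
    using w \<Omega> borel_measurable_restrict_space_iff[of \<Omega> lebesgue w] by simp
  have m': "w' \<in> borel_measurable lebesgue"
    by (rule measurable_completion) simp
  have eq': "AE x in lebesgue. indicator \<Omega> x * w x = w' x"
    using eq by (auto simp: eq_commute intro: AE_completion)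
  have "integrable (lebesgue_on \<Omega>) w \<longleftrightarrow> integrable lebesgue (\<lambda>x. indicator \<Omega> x * w x)"
    using \<Omega> by (subst integrable_restrict_space) auto
  also have "\<dots> \<longleftrightarrow> integrable lebesgue w'"
    by (rule integrable_cong_AE[OF m m' eq'])
  finally show "integrable (lebesgue_on \<Omega>) w \<longleftrightarrow> integrable lborel w'"
    by (simp add: integrable_completion)
  have "integral\<^sup>L (lebesgue_on \<Omega>) w = integral\<^sup>L lebesgue (\<lambda>x. indicator \<Omega> x * w x)"
    using \<Omega> by (subst integral_restrict_space) auto
  also have "\<dots> = integral\<^sup>L lebesgue w'"
    by (rule integral_cong_AE[OF m m' eq'])
  finally show "integral\<^sup>L (lebesgue_on \<Omega>) w = (LINT x|lborel. w' x)"
    by (simp add: integral_completion)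
qed

text \<open>The simple functions that witness the Bochner integrability of \<open>\<phi> G\<close>, divided by
  \<open>\<phi>\<close>, approximate \<open>G\<close> where \<open>\<phi>\<close> is bounded away from \<open>0\<close>.  Dividing turns a
  simple function into a finite sum of vectors \<open>b\<close> times scalar functions \<open>a b\<close>.\<close>
lemma finite_rank_approximation:
  fixes G :: "'a::euclidean_space \<Rightarrow> linf"
  assumes int: "has_bochner_int (lebesgue_on \<Omega>) (\<lambda>x. \<phi> x *\<^sub>R G x) v"
    and \<Omega>: "\<Omega> \<in> sets lebesgue" and \<phi>[measurable]: "\<phi> \<in> borel_measurable borel"
    and K[measurable]: "K \<in> sets borel" "K \<subseteq> \<Omega>" and c: "c > 0" "\<And>x. x \<in> K \<Longrightarrow> c \<le> \<phi> x"
    and g: "AE x in lborel. \<forall>i. g i x = indicator \<Omega> x * apply_bcontfun (G x) i"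
    and \<epsilon>: "(\<epsilon>::real) > 0"
  shows "\<exists>S a. finite S \<and> (\<forall>b\<in>S. integrable lborel (a b)) \<and>
    (\<integral>\<^sup>+x. (SUP i. ennreal \<bar>indicator K x * g i x - (\<Sum>b\<in>S. apply_bcontfun b i * a b x)\<bar>) \<partial>lborel) \<le> \<epsilon>"
proof -
  let ?M = "lebesgue_on \<Omega>"
  obtain t where t: "\<And>i. Bochner_Integration.simple_bochner_integrable ?M (t i)"
    and "(\<lambda>i. \<integral>\<^sup>+x. ennreal (norm (\<phi> x *\<^sub>R G x - t i x)) \<partial>?M) \<longlonglongrightarrow> 0"
    using int unfolding has_bochner_int_def by blast
  from order_tendstoD(2)[OF this(2), of "ennreal (c * \<epsilon>)"] c \<epsilon>
  obtain k where k: "(\<integral>\<^sup>+x. ennreal (norm (\<phi> x *\<^sub>R G x - t k x)) \<partial>?M) < ennreal (c * \<epsilon>)"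
    by (auto simp: eventually_sequentially ennreal_zero_less_mult_iff)
  define s where "s = t k"
  have s: "simple_function ?M s" "emeasure ?M {x\<in>space ?M. s x \<noteq> 0} \<noteq> \<infinity>"
    using t[of k] by (auto simp: s_def elim: simple_bochner_integrable.cases)
  \<comment> \<open>Without 0, all level sets of the values in S have finite measure.\<close>
  define S where "S = s ` \<Omega> - {0}"
  have S: "finite S"
    using s(1) by (simp add: S_def simple_function_def)
  have inv: "1 / \<bar>\<phi> x\<bar> \<le> 1 / c" if "x \<in> K" for x
    using c(1) c(2)[OF that] by (intro frac_le) auto
  have "\<exists>a. integrable lborel a \<and>
      (AE x in lborel. a x = indicator {x \<in> K. s x = b} x / \<phi> x)" if "b \<in> S" for b
  proof -
    let ?A = "{x \<in> \<Omega>. s x = b}"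
    let ?w = "\<lambda>x. indicator {x \<in> K. s x = b} x / \<phi> x"
    have A: "?A \<in> sets ?M"
      using simple_functionD(2)[OF s(1), of "{b}"] by (auto simp: vimage_def Int_def conj_commute)
    have "{x \<in> space ?M. s x \<noteq> 0} = s -` (- {0}) \<inter> space ?M"
      by auto
    also have "\<dots> \<in> sets ?M"
      by (rule simple_functionD(2)[OF s(1)])
    finally have "emeasure ?M ?A \<le> emeasure ?M {x\<in>space ?M. s x \<noteq> 0}"
      using that by (intro emeasure_mono) (auto simp: S_def)
    with s(2) have fin: "emeasure ?M ?A < \<infinity>"
      by (auto simp: less_top[symmetric] top_unique)
    have KA: "{x \<in> K. s x = b} = K \<inter> ?A"
      using K by auto
    have Am: "?A \<in> sets lebesgue"
      using A \<Omega> by (simp add: sets_restrict_space_iff)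
    have w: "?w \<in> borel_measurable lebesgue"
    proof -
      have "K \<inter> ?A \<in> sets lebesgue"
        using Am K(1) by auto
      moreover have "\<phi> \<in> borel_measurable lebesgue"
        by (rule measurable_completion) simp
      ultimately show ?thesis
        unfolding KA by (intro borel_measurable_divide borel_measurable_indicator)
    qed
    from completion_ex_borel_measurable_real[OF w]
    obtain a where a: "a \<in> borel_measurable borel" "AE x in lborel. ?w x = a x"
      by auto
    have "integrable lebesgue ?w"
    proof (rule Bochner_Integration.integrable_bound[OF _ w])
      show "integrable lebesgue (\<lambda>x. (1 / c) * indicator ?A x :: real)"
        using Am fin \<Omega> by (intro integrable_mult_right integrable_real_indicator)
          (auto simp: emeasure_restrict_space)
      show "AE x in lebesgue. norm (?w x) \<le> norm ((1 / c) * indicator ?A x :: real)"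
        using c(1) K(2) inv by (intro AE_I2) (auto simp: indicator_def)
    qed
    moreover have "a \<in> borel_measurable lebesgue"
      by (rule measurable_completion) (use a(1) in simp)
    ultimately have "integrable lebesgue a"
      using integrable_cong_AE[OF w _ AE_completion[OF a(2)]] by blast
    then have "integrable lborel a"
      using a by (simp add: integrable_completion)
    with a(2) show ?thesis by (intro exI[of _ a] conjI) (auto simp: eq_commute)
  qed
  then obtain a where a: "\<And>b. b \<in> S \<Longrightarrow> integrable lborel (a b)"
      "\<And>b. b \<in> S \<Longrightarrow> AE x in lborel. a b x = indicator {x \<in> K. s x = b} x / \<phi> x"
    by metis
  have ae: "AE x in lborel. \<forall>b\<in>S. a b x = indicator {x \<in> K. s x = b} x / \<phi> x"
    using S a(2) by (simp add: AE_finite_all)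
  have "(\<integral>\<^sup>+x. (SUP i. ennreal \<bar>indicator K x * g i x - (\<Sum>b\<in>S. apply_bcontfun b i * a b x)\<bar>) \<partial>lborel)
      \<le> (\<integral>\<^sup>+x. ennreal (1 / c) * (ennreal (norm (\<phi> x *\<^sub>R G x - s x)) * indicator \<Omega> x) \<partial>lborel)"
  proof (rule nn_integral_mono_AE, use g ae in eventually_elim)
    case (elim x)
    show ?case
    proof (cases "x \<in> K")
      case False
      with elim show ?thesis by simp
    next
      case True
      then have x: "x \<in> \<Omega>" "\<phi> x > 0" "c \<le> \<phi> x"
        using K c by (auto intro: order.strict_trans2)
      have "(\<Sum>b\<in>S. apply_bcontfun b i * a b x) = apply_bcontfun (s x) i / \<phi> x" for i
      proof -
        have "(\<Sum>b\<in>S. apply_bcontfun b i * a b x) = (\<Sum>b\<in>S. if b = s x then apply_bcontfun (s x) i / \<phi> x else 0)"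
          using elim True by (intro sum.cong) (auto simp: indicator_def)
        then show ?thesis
          using S x by (auto simp: S_def)
      qed
      moreover have "\<bar>apply_bcontfun (G x) i - apply_bcontfun (s x) i / \<phi> x\<bar> \<le> 1 / c * norm (\<phi> x *\<^sub>R G x - s x)" for i
      proof -
        have "\<bar>apply_bcontfun (G x) i - apply_bcontfun (s x) i / \<phi> x\<bar> =
            \<bar>apply_bcontfun (\<phi> x *\<^sub>R G x - s x) i / \<phi> x\<bar>"
          using x by (simp add: minus_bcontfun.rep_eq scaleR_bcontfun.rep_eq diff_divide_distrib)
        also have "\<dots> = \<bar>apply_bcontfun (\<phi> x *\<^sub>R G x - s x) i\<bar> / \<phi> x"
          using x by simp
        also have "\<dots> \<le> norm (\<phi> x *\<^sub>R G x - s x) / c"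
          using norm_bounded[of "\<phi> x *\<^sub>R G x - s x" i] x c by (intro frac_le) auto
        finally show ?thesis by simp
      qed
      ultimately show ?thesis
        using elim True x c by (auto intro!: SUP_least ennreal_leI simp flip: ennreal_mult')
    qed
  qed
  also have "\<dots> = (\<integral>\<^sup>+x. ennreal (1 / c) * (ennreal (norm (\<phi> x *\<^sub>R G x - s x)) * indicator \<Omega> x) \<partial>lebesgue)"
    by (rule nn_integral_completion[symmetric])
  also have "\<dots> = (\<integral>\<^sup>+x. ennreal (1 / c) * ennreal (norm (\<phi> x *\<^sub>R G x - s x)) \<partial>?M)"
    using \<Omega> by (subst nn_integral_restrict_space) (auto simp: mult.assoc)
  also have "\<dots> = ennreal (1 / c) * (\<integral>\<^sup>+x. ennreal (norm (\<phi> x *\<^sub>R G x - s x)) \<partial>?M)"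
    using int s(1) unfolding has_bochner_int_def
    by (intro nn_integral_cmult measurable_compose[OF borel_measurable_norm_diff_simple_function measurable_ennreal]) auto
  also have "\<dots> \<le> ennreal (1 / c) * ennreal (c * \<epsilon>)"
    using k by (intro mult_left_mono) (auto simp: s_def)
  also have "\<dots> = ennreal \<epsilon>"
    using c \<epsilon> by (simp flip: ennreal_mult'')
  finally show ?thesis
    using S a(1) by (intro exI[of _ S] exI[of _ a]) auto
qed

section \<open>Families whose first differences are controlled by second differences\<close>

lemma AE_ex_in_open:
  fixes U :: "'a::euclidean_space set"
  assumes "AE x in lborel. P x" "open U" "U \<noteq> {}"
  shows "\<exists>x\<in>U. P x"
proof (rule ccontr)
  assume contra: "\<not> (\<exists>x\<in>U. P x)"
  from assms(1) have "AE x in lebesgue. P x"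
    by (rule AE_completion)
  then have "AE x in lebesgue. x \<in> U \<longrightarrow> x \<in> {}"
    by eventually_elim (use contra in auto)
  with assms(2,3) show False
    using mem_closed_if_AE_lebesgue_open[of U "{}"] by auto
qed

text \<open>The functions \<open>u i\<close> stand for the coordinates of a map into \<open>\<ell>\<^sup>\<infinity>\<close> and \<open>g j i\<close> for those of its
  \<open>j\<close>-th weak derivative.  On the set \<open>A\<close>, which is conull in \<open>\<Omega>\<close>, the Borel functions \<open>u i\<close> agree
  with the actual coordinates, and the kink of the distance functions gives
  \<open>second_difference\<close>.  The box \<open>box a b\<close> in \<open>L1_continuity\<close> leaves room for a test
  function that is bounded away from \<open>0\<close> on \<open>cbox p q\<close>.\<close>
locale kuratowski_sobolev_family =
  fixes \<Omega> :: "(real^'n) set" and u :: "nat \<Rightarrow> real^'n \<Rightarrow> real"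
    and g :: "'n \<Rightarrow> nat \<Rightarrow> real^'n \<Rightarrow> real" and A :: "(real^'n) set"
  assumes open_domain: "open \<Omega>"
    and u: "\<And>i. integrable lborel (u i)"
    and g: "\<And>j i. integrable lborel (g j i)"
    and weak: "\<And>i j \<phi>. \<phi> \<in> test_functions \<Omega> \<Longrightarrow>
        (LINT x|lborel. u i x * partial_deriv j \<phi> x) = - (LINT x|lborel. g j i x * \<phi> x)"
    and A: "AE x in lborel. x \<in> \<Omega> \<longrightarrow> x \<in> A"
    and second_difference: "\<And>x y z. x \<in> A \<Longrightarrow> y \<in> A \<Longrightarrow> z \<in> A \<Longrightarrow>
        (SUP i. ennreal \<bar>u i y - u i x\<bar>) \<le> (SUP i. ennreal \<bar>u i y - 2 * u i x + u i z\<bar>)"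
    and L1_continuity: "\<And>j p q a b s. cbox p q \<subseteq> box a b \<Longrightarrow> cbox a b \<subseteq> \<Omega> \<Longrightarrow> s \<longlonglongrightarrow> 0 \<Longrightarrow>
        (\<lambda>k. \<integral>\<^sup>+x. (SUP i. ennreal \<bar>indicator (cbox p q) (x + s k) * g j i (x + s k) -
            indicator (cbox p q) x * g j i x\<bar>) \<partial>lborel) \<longlonglongrightarrow> 0"
begin

lemma measurable_u_g[measurable]: "u i \<in> borel_measurable borel" "g j i \<in> borel_measurable borel"
  using u g by (auto dest: borel_measurable_integrable)

text \<open>This is \<open>\<parallel>F (x + v) - F x\<parallel>\<close> for the map \<open>F\<close> with coordinates \<open>u i\<close>.\<close>
definition osc :: "real^'n \<Rightarrow> real^'n \<Rightarrow> ennreal" where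
  "osc v x = (SUP i. ennreal \<bar>u i (x + v) - u i x\<bar>)"

lemma measurable_osc[measurable]: "(\<lambda>x. osc (f x) (h x)) \<in> borel_measurable M"
  if [measurable]: "f \<in> M \<rightarrow>\<^sub>M borel" "h \<in> M \<rightarrow>\<^sub>M borel"
  unfolding osc_def by measurable

lemma osc_zero[simp]: "osc 0 x = 0"
  by (simp add: osc_def)

lemma osc_add: "osc (v + w) x \<le> osc v x + osc w (x + v)"
  unfolding osc_def
proof (rule SUP_least)
  fix i
  have "ennreal \<bar>u i (x + (v + w)) - u i x\<bar> \<le>
      ennreal \<bar>u i (x + v) - u i x\<bar> + ennreal \<bar>u i (x + v + w) - u i (x + v)\<bar>"
    by (simp add: add.assoc flip: ennreal_plus)
  also have "\<dots> \<le> (SUP i. ennreal \<bar>u i (x + v) - u i x\<bar>) + (SUP i. ennreal \<bar>u i (x + v + w) - u i (x + v)\<bar>)"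
    by (intro add_mono SUP_upper) auto
  finally show "ennreal \<bar>u i (x + (v + w)) - u i x\<bar> \<le> \<dots>" .
qed

lemma osc_multiple: "osc (real n *\<^sub>R v) x \<le> (\<Sum>k<n. osc v (x + real k *\<^sub>R v))"
proof (induction n)
  case (Suc n)
  have "osc (real (Suc n) *\<^sub>R v) x \<le> osc (real n *\<^sub>R v) x + osc v (x + real n *\<^sub>R v)"
    using osc_add[of "real n *\<^sub>R v" v x] by (simp add: algebra_simps)
  also have "\<dots> \<le> (\<Sum>k<n. osc v (x + real k *\<^sub>R v)) + osc v (x + real n *\<^sub>R v)"
    by (intro add_mono Suc.IH order_refl)
  finally show ?case by simp
qed simp

lemma osc_eq_0D: "osc v x = 0 \<Longrightarrow> u i (x + v) = u i x"
  using SUP_upper[of i UNIV "\<lambda>i. ennreal \<bar>u i (x + v) - u i x\<bar>"] by (simp add: osc_def)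

text \<open>The first difference is bounded by the second one, which is
  \<open>\<integral>\<^sub>0\<^sup>h (g (x + t e) - g (x + t e - h e)) dt\<close> in each coordinate.  Integrating over \<open>x\<close> first turns
  this into \<open>h\<close> times a quantity that tends to \<open>0\<close> with \<open>h\<close>.\<close>
lemma integral_osc_step_le:
  assumes K: "cbox p' q' \<subseteq> \<Omega>" and h: "0 < h"
    and inside: "\<And>x t. x \<in> cbox p q \<Longrightarrow> \<bar>t\<bar> \<le> h \<Longrightarrow> x + t *\<^sub>R axis j 1 \<in> cbox p' q'"
  shows "(\<integral>\<^sup>+x. osc (h *\<^sub>R axis j 1) x * indicator (box p q) x \<partial>lborel) \<le>
    ennreal h * (\<integral>\<^sup>+x. (SUP i. ennreal \<bar>indicator (cbox p' q') (x + (- h) *\<^sub>R axis j 1) * g j i (x + (- h) *\<^sub>R axis j 1) -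
            indicator (cbox p' q') x * g j i x\<bar>) \<partial>lborel)"
proof -
  let ?e = "axis j 1 :: real^'n"
  define D where "D x = (SUP i. ennreal \<bar>indicator (cbox p' q') (x + (- h) *\<^sub>R ?e) * g j i (x + (- h) *\<^sub>R ?e) -
            indicator (cbox p' q') x * g j i x\<bar>)" for x
  have [measurable]: "D \<in> borel_measurable borel"
    unfolding D_def by measurable
  define I where "I i x = (LINT t|lborel. indicator {0..h} t * g j i (x + t *\<^sub>R ?e))" for i x
  have line: "AE x in lborel. x \<in> box a b \<longrightarrow> u i (x + h *\<^sub>R ?e) - u i x = I i x"
    if "\<And>x t. x \<in> cbox a b \<Longrightarrow> t \<in> {0..h} \<Longrightarrow> x + t *\<^sub>R ?e \<in> cbox p' q'" for a b i
    unfolding I_def using h that K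
    by (intro AE_difference_eq_line_integral[OF u g weak]) auto
  have int: "AE x in lborel. integrable lborel (\<lambda>t. indicator {0..h} t * g j i (x + t *\<^sub>R ?e))" for i
    by (rule lborel_pair.AE_integrable_fst[OF integrable_translates_along_interval[OF g]])
  have shifted: "x + t *\<^sub>R ?e \<in> cbox p' q'"
    if "x \<in> cbox (p - h *\<^sub>R ?e) (q - h *\<^sub>R ?e)" "t \<in> {0..h}" for x t
  proof -
    have "x + h *\<^sub>R ?e \<in> cbox p q"
      using that(1) by (simp add: mem_box_cart algebra_simps)
    from inside[OF this, of "t - h"] that(2) show ?thesis
      by (simp add: algebra_simps)
  qed
  have l1: "AE x in lborel. \<forall>i. x \<in> box p q \<longrightarrow> u i (x + h *\<^sub>R ?e) - u i x = I i x"
    using inside by (intro AE_all_countable[THEN iffD2] allI line) auto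
  have "AE x in lborel. \<forall>i. x \<in> box (p - h *\<^sub>R ?e) (q - h *\<^sub>R ?e) \<longrightarrow> u i (x + h *\<^sub>R ?e) - u i x = I i x"
    using shifted by (intro AE_all_countable[THEN iffD2] allI line)
  from lborel_AE_translate[OF this, of "- h *\<^sub>R ?e"]
  have l2: "AE x in lborel. \<forall>i. x \<in> box p q \<longrightarrow> u i x - u i (x - h *\<^sub>R ?e) = I i (x - h *\<^sub>R ?e)"
    by (simp add: mem_box_cart)
  have i1: "AE x in lborel. \<forall>i. integrable lborel (\<lambda>t. indicator {0..h} t * g j i (x + t *\<^sub>R ?e))"
    using int by (simp add: AE_all_countable)
  note i2 = lborel_AE_translate[OF i1, of "- h *\<^sub>R ?e"]
  have "AE x in lborel. osc (h *\<^sub>R ?e) x * indicator (box p q) x \<le>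
      (\<integral>\<^sup>+t. indicator {0..h} t * D (x + t *\<^sub>R ?e) \<partial>lborel)"
    using l1 l2 i1 i2 A lborel_AE_translate[OF A, of "h *\<^sub>R ?e"] lborel_AE_translate[OF A, of "- h *\<^sub>R ?e"]
  proof eventually_elim
    case (elim x)
    show ?case
    proof (cases "x \<in> box p q")
      case True
      then have x: "x \<in> cbox p q"
        using box_subset_cbox by blast
      have "x \<in> A" "x + h *\<^sub>R ?e \<in> A" "x - h *\<^sub>R ?e \<in> A"
        using inside[OF x, of 0] inside[OF x, of h] inside[OF x, of "-h"] h K elim by auto
      then have "osc (h *\<^sub>R ?e) x \<le> (SUP i. ennreal \<bar>u i (x + h *\<^sub>R ?e) - 2 * u i x + u i (x - h *\<^sub>R ?e)\<bar>)"
        unfolding osc_def by (rule second_difference)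
      also have "\<dots> \<le> (\<integral>\<^sup>+t. indicator {0..h} t * D (x + t *\<^sub>R ?e) \<partial>lborel)"
      proof (rule SUP_least)
        fix i
        let ?k = "\<lambda>t. indicator {0..h} t * g j i (x + t *\<^sub>R ?e) - indicator {0..h} t * g j i (x - h *\<^sub>R ?e + t *\<^sub>R ?e)"
        have k: "integrable lborel ?k"
          using elim by (intro Bochner_Integration.integrable_diff) auto
        have "u i (x + h *\<^sub>R ?e) - 2 * u i x + u i (x - h *\<^sub>R ?e) = I i x - I i (x - h *\<^sub>R ?e)"
          using elim(1,2) True by (smt (verit))
        also have "\<dots> = (LINT t|lborel. ?k t)"
          unfolding I_def using elim by (intro Bochner_Integration.integral_diff[symmetric]) auto
        finally have "ennreal \<bar>u i (x + h *\<^sub>R ?e) - 2 * u i x + u i (x - h *\<^sub>R ?e)\<bar> \<le>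
            (\<integral>\<^sup>+t. norm (?k t) \<partial>lborel)"
          using integral_norm_bound_ennreal[OF k] by simp
        also have "\<dots> \<le> (\<integral>\<^sup>+t. indicator {0..h} t * D (x + t *\<^sub>R ?e) \<partial>lborel)"
        proof (rule nn_integral_mono)
          fix t
          show "ennreal (norm (?k t)) \<le> indicator {0..h} t * D (x + t *\<^sub>R ?e)"
          proof (cases "t \<in> {0..h}")
            case t: True
            then have "x + t *\<^sub>R ?e \<in> cbox p' q'" "x + (t - h) *\<^sub>R ?e \<in> cbox p' q'"
              using inside[OF x, of t] inside[OF x, of "t - h"] by auto
            then have "ennreal (norm (?k t)) = ennreal \<bar>indicator (cbox p' q') (x + t *\<^sub>R ?e + (- h) *\<^sub>R ?e) *
                g j i (x + t *\<^sub>R ?e + (- h) *\<^sub>R ?e) - indicator (cbox p' q') (x + t *\<^sub>R ?e) * g j i (x + t *\<^sub>R ?e)\<bar>"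
              using t by (simp add: algebra_simps abs_minus_commute)
            also have "\<dots> \<le> D (x + t *\<^sub>R ?e)"
              unfolding D_def by (rule SUP_upper) simp
            finally show ?thesis using t by simp
          qed simp
        qed
        finally show "ennreal \<bar>u i (x + h *\<^sub>R ?e) - 2 * u i x + u i (x - h *\<^sub>R ?e)\<bar> \<le> \<dots>" .
      qed
      finally show ?thesis using True by simp
    qed simp
  qed
  then have "(\<integral>\<^sup>+x. osc (h *\<^sub>R ?e) x * indicator (box p q) x \<partial>lborel) \<le>
      (\<integral>\<^sup>+x. \<integral>\<^sup>+t. indicator {0..h} t * D (x + t *\<^sub>R ?e) \<partial>lborel \<partial>lborel)"
    by (rule nn_integral_mono_AE)
  also have "\<dots> = (\<integral>\<^sup>+t. \<integral>\<^sup>+x. indicator {0..h} t * D (x + t *\<^sub>R ?e) \<partial>lborel \<partial>lborel)"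
    by (rule lborel_pair.Fubini'[symmetric]) measurable
  also have "\<dots> = (\<integral>\<^sup>+t. indicator {0..h} t * (\<integral>\<^sup>+x. D x \<partial>lborel) \<partial>lborel)"
    by (simp add: nn_integral_cmult lborel_nn_integral_translate)
  also have "\<dots> = ennreal h * (\<integral>\<^sup>+x. D x \<partial>lborel)"
    using h by (simp add: nn_integral_multc)
  finally show ?thesis
    unfolding D_def .
qed

text \<open>The segment from \<open>x\<close> to \<open>x + t e\<close> stays in the box by convexity.  Subdividing it into \<open>Suc N\<close>
  pieces of length \<open>h N\<close> gives the bound \<open>Suc N * (h N * w N) = t * w N\<close>, and \<open>w N\<close> tends to \<open>0\<close>.\<close>
lemma AE_osc_axis_eq_0:
  assumes K: "cbox p' q' \<subseteq> box a b" "cbox a b \<subseteq> \<Omega>" and d: "0 < d"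
    and inside: "\<And>x t. x \<in> cbox p q \<Longrightarrow> \<bar>t\<bar> \<le> d \<Longrightarrow> x + t *\<^sub>R axis j 1 \<in> cbox p' q'"
    and t: "0 \<le> t"
  shows "AE x in lborel. x \<in> box p q \<longrightarrow> x + t *\<^sub>R axis j 1 \<in> box p q \<longrightarrow> osc (t *\<^sub>R axis j 1) x = 0"
proof (cases "t = 0")
  case False
  with t have t: "t > 0" by simp
  let ?e = "axis j 1 :: real^'n"
  have K': "cbox p' q' \<subseteq> \<Omega>"
    using K box_subset_cbox[of a b] by blast
  define B where "B = {x \<in> box p q. x + t *\<^sub>R ?e \<in> box p q}"
  have [measurable]: "B \<in> sets borel"
    unfolding B_def by measurable
  \<comment> \<open>The length of the pieces, and the modulus of continuity of g at that scale.\<close>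
  define h where "h N = t / real (Suc N)" for N
  define w where "w N = (\<integral>\<^sup>+x. (SUP i. ennreal \<bar>indicator (cbox p' q') (x + (- h N) *\<^sub>R ?e) * g j i (x + (- h N) *\<^sub>R ?e) -
            indicator (cbox p' q') x * g j i x\<bar>) \<partial>lborel)" for N
  have h: "h N > 0" "real (Suc N) * h N = t" for N
    using t by (auto simp: h_def)
  have h0: "h \<longlonglongrightarrow> 0"
    using tendsto_mult_right_zero[OF LIMSEQ_inverse_real_of_nat, of t] by (simp add: h_def[abs_def] divide_inverse)
  have "(\<lambda>N. (- h N) *\<^sub>R ?e) \<longlonglongrightarrow> (- 0) *\<^sub>R ?e"
    by (intro tendsto_intros h0)
  then have "w \<longlonglongrightarrow> 0"
    unfolding w_def using L1_continuity[OF K, of "\<lambda>N. (- h N) *\<^sub>R ?e"] by simp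
  then have "(\<lambda>N. ennreal t * w N) \<longlonglongrightarrow> ennreal t * 0"
    by (intro tendsto_mult_ennreal tendsto_const) auto
  moreover have "(\<integral>\<^sup>+x. osc (t *\<^sub>R ?e) x * indicator B x \<partial>lborel) \<le> ennreal t * w N" if "h N \<le> d" for N
  proof -
    have "(\<integral>\<^sup>+x. osc (t *\<^sub>R ?e) x * indicator B x \<partial>lborel) \<le>
        (\<integral>\<^sup>+x. (\<Sum>k<Suc N. osc (h N *\<^sub>R ?e) (x + (real k * h N) *\<^sub>R ?e) * indicator (box p q) (x + (real k * h N) *\<^sub>R ?e)) \<partial>lborel)"
    proof (rule nn_integral_mono)
      fix x
      show "osc (t *\<^sub>R ?e) x * indicator B x \<le>
          (\<Sum>k<Suc N. osc (h N *\<^sub>R ?e) (x + (real k * h N) *\<^sub>R ?e) * indicator (box p q) (x + (real k * h N) *\<^sub>R ?e))"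
      proof (cases "x \<in> B")
        case True
        have "x + (real k * h N) *\<^sub>R ?e \<in> box p q" if "k < Suc N" for k
        proof -
          have "0 \<le> real k * h N" "real k * h N \<le> t"
            using h[of N] that mult_right_mono[of "real k" "real (Suc N)" "h N"] by auto
          with True show ?thesis
            by (auto simp: B_def mem_box_cart axis_def intro: add_strict_increasing2 order.strict_trans1 split: if_splits)
              (smt (verit))+
        qed
        then show ?thesis
          using True osc_multiple[of "Suc N" "h N *\<^sub>R ?e" x] h(2)[of N] by simp
      qed simp
    qed
    also have "\<dots> = (\<Sum>k<Suc N. \<integral>\<^sup>+x. osc (h N *\<^sub>R ?e) (x + (real k * h N) *\<^sub>R ?e) * indicator (box p q) (x + (real k * h N) *\<^sub>R ?e) \<partial>lborel)"
      by (rule nn_integral_sum) measurable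
    also have "\<dots> = (\<Sum>k<Suc N. \<integral>\<^sup>+x. osc (h N *\<^sub>R ?e) x * indicator (box p q) x \<partial>lborel)"
      by (intro sum.cong refl lborel_nn_integral_translate[of "\<lambda>x. osc (h N *\<^sub>R ?e) x * indicator (box p q) x"]) measurable
    also have "\<dots> \<le> (\<Sum>k<Suc N. ennreal (h N) * w N)"
      unfolding w_def using inside that h
      by (intro sum_mono integral_osc_step_le K')
        (auto intro: order.trans)
    also have "\<dots> = ennreal t * w N"
    proof -
      have "of_nat (Suc N) * ennreal (h N) = ennreal t"
        using h[of N] by (simp add: ennreal_of_nat_eq_real_of_nat del: of_nat_Suc flip: ennreal_mult)
      then show ?thesis
        by (simp add: mult.assoc[symmetric] del: of_nat_Suc)
    qed
    finally show ?thesis .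
  qed
  moreover have "eventually (\<lambda>N. h N \<le> d) sequentially"
    using order_tendstoD(2)[OF h0 d] by eventually_elim simp
  ultimately have "(\<integral>\<^sup>+x. osc (t *\<^sub>R ?e) x * indicator B x \<partial>lborel) \<le> ennreal t * 0"
    by (intro tendsto_lowerbound[of "\<lambda>N. ennreal t * w N"]) (auto elim: eventually_mono)
  then have "AE x in lborel. osc (t *\<^sub>R ?e) x * indicator B x = 0"
    by (subst nn_integral_0_iff_AE[symmetric]) auto
  then show ?thesis
    by eventually_elim (auto simp: B_def)
qed simp

text \<open>The coordinates of \<open>v\<close> are switched on one at a time.  As they are nonnegative, the intermediate
  points lie between \<open>x\<close> and \<open>x + v\<close> in each coordinate, hence in the box.\<close>
lemma AE_osc_orthant_eq_0:
  assumes K: "cbox p' q' \<subseteq> box a b" "cbox a b \<subseteq> \<Omega>" and d: "0 < d"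
    and inside: "\<And>x t j. x \<in> cbox p q \<Longrightarrow> \<bar>t\<bar> \<le> d \<Longrightarrow> x + t *\<^sub>R axis j 1 \<in> cbox p' q'"
    and v: "\<And>i. 0 \<le> v $ i"
  shows "AE x in lborel. x \<in> box p q \<longrightarrow> x + v \<in> box p q \<longrightarrow> osc v x = 0"
proof -
  define w where "w J = (\<chi> i. if i \<in> J then v $ i else 0)" for J
  have "AE x in lborel. x \<in> box p q \<longrightarrow> x + v \<in> box p q \<longrightarrow> osc (w J) x = 0" if "finite J" for J
    using that
  proof (induction J rule: finite_induct)
    case empty
    have "w {} = 0"
      by (simp add: w_def vec_eq_iff)
    then show ?case
      by simp
  next
    case (insert j J)
    from insert.hyps have w: "w (insert j J) = w J + (v $ j) *\<^sub>R axis j 1"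
      by (auto simp: w_def vec_eq_iff axis_def)
    have "AE x in lborel. x \<in> box p q \<longrightarrow> x + (v $ j) *\<^sub>R axis j 1 \<in> box p q \<longrightarrow> osc ((v $ j) *\<^sub>R axis j 1) x = 0"
      by (rule AE_osc_axis_eq_0[OF K d inside v])
    from lborel_AE_translate[OF this, of "w J"] insert.IH
    show ?case
    proof eventually_elim
      case (elim x)
      show ?case
      proof (intro impI)
        assume x: "x \<in> box p q" "x + v \<in> box p q"
        have between: "x + w J' \<in> box p q" for J'
          unfolding mem_box_cart
        proof
          fix i
          have "p $ i < x $ i" "x $ i + v $ i < q $ i" "0 \<le> v $ i"
            using x v by (auto simp: mem_box_cart)
          then show "p $ i < (x + w J') $ i \<and> (x + w J') $ i < q $ i"
            by (auto simp: w_def)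
        qed
        have "osc (w (insert j J)) x \<le> osc (w J) x + osc ((v $ j) *\<^sub>R axis j 1) (x + w J)"
          unfolding w by (rule osc_add)
        also have "\<dots> = 0"
          using elim x between[of J] between[of "insert j J"] by (simp add: w add.assoc)
        finally show "osc (w (insert j J)) x = 0" by simp
      qed
    qed
  qed
  from this[of UNIV] show ?thesis
    by (simp add: w_def)
qed

text \<open>By Fubini's theorem, almost every \<open>x\<close> satisfies \<open>u i (x + v) = u i x\<close> for almost every \<open>v\<close> in the
  positive orthant.  Such a point \<open>x\<close> is chosen below \<open>x0\<close> in all coordinates, so that the points
  \<open>x + v\<close> cover a neighbourhood of \<open>x0\<close>.\<close>
lemma ex_AE_constant_near:
  assumes "x0 \<in> \<Omega>"
  shows "\<exists>r>0. \<exists>c. AE y in lborel. y \<in> ball x0 r \<longrightarrow> (\<forall>i. u i y = c i)"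
proof -
  obtain e where e: "e > 0" "ball x0 e \<subseteq> \<Omega>"
    using open_domain assms open_contains_ball by blast
  define r where "r = e / (4 * real CARD('n))"
  have r: "r > 0"
    using e by (simp add: r_def)
  define p q p' q' a b where "p = x0 - vec r" and "q = x0 + vec r"
    and "p' = x0 - vec (2 * r)" and "q' = x0 + vec (2 * r)"
    and "a = x0 - vec (3 * r)" and "b = x0 + vec (3 * r)"
  note pq = p_def q_def p'_def q'_def a_def b_def
  have K1: "cbox p' q' \<subseteq> box a b"
  proof
    fix x
    assume x: "x \<in> cbox p' q'"
    show "x \<in> box a b"
      unfolding mem_box_cart
    proof
      fix i
      have "p' $ i \<le> x $ i" "x $ i \<le> q' $ i"
        using x by (auto simp: mem_box_cart)
      then show "a $ i < x $ i \<and> x $ i < b $ i"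
        using r by (auto simp: pq)
    qed
  qed
  have K2: "cbox a b \<subseteq> \<Omega>"
  proof
    fix x
    assume "x \<in> cbox a b"
    then have "\<bar>(x - x0) $ i\<bar> \<le> 3 * r" for i
      by (auto simp: pq mem_box_cart abs_le_iff algebra_simps)
    then have "(\<Sum>i\<in>UNIV. \<bar>(x - x0) $ i\<bar>) \<le> real CARD('n) * (3 * r)"
      using sum_bounded_above[of UNIV "\<lambda>i. \<bar>(x - x0) $ i\<bar>" "3 * r"] by simp
    also have "\<dots> = 3 / 4 * e"
      by (simp add: r_def)
    finally have "norm (x - x0) < e"
      using norm_le_l1_cart[of "x - x0"] e(1) by linarith
    then show "x \<in> \<Omega>"
      using e(2) by (auto simp: dist_norm norm_minus_commute)
  qed
  have inside: "x + t *\<^sub>R axis j 1 \<in> cbox p' q'" if "x \<in> cbox p q" "\<bar>t\<bar> \<le> r" for x t j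
    unfolding mem_box_cart
  proof
    fix i
    have "p $ i \<le> x $ i" "x $ i \<le> q $ i"
      using that(1) by (auto simp: mem_box_cart)
    then show "p' $ i \<le> (x + t *\<^sub>R axis j 1) $ i \<and> (x + t *\<^sub>R axis j 1) $ i \<le> q' $ i"
      using that(2) r by (auto simp: pq axis_def)
  qed
  define Q :: "(real^'n) set" where "Q = {v. \<forall>i. 0 \<le> v $ i}"
  have "closed Q"
    unfolding Q_def by (intro closed_Collect_all closed_Collect_le continuous_intros)
  then have [measurable]: "Q \<in> sets borel" by simp
  let ?P = "\<lambda>x v. v \<in> Q \<longrightarrow> x \<in> box p q \<longrightarrow> x + v \<in> box p q \<longrightarrow> osc v x = 0"
  have meas: "{z \<in> space (lborel \<Otimes>\<^sub>M lborel). ?P (fst z) (snd z)} \<in> sets (lborel \<Otimes>\<^sub>M lborel)"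
    by measurable
  have "AE v in lborel. AE x in lborel. ?P x v"
  proof (rule AE_I2)
    fix v :: "real^'n"
    show "AE x in lborel. ?P x v"
    proof (cases "v \<in> Q")
      case True
      then have "AE x in lborel. x \<in> box p q \<longrightarrow> x + v \<in> box p q \<longrightarrow> osc v x = 0"
        by (intro AE_osc_orthant_eq_0[OF K1 K2 r inside]) (auto simp: Q_def)
      then show ?thesis
        by (rule eventually_mono) simp
    qed auto
  qed
  then have "AE x in lborel. AE v in lborel. ?P x v"
    by (rule lborel_pair.AE_commute[THEN iffD2, rotated]) (rule meas)
  moreover have "box p x0 \<noteq> {}"
    using r by (simp add: pq interval_ne_empty_cart)
  ultimately obtain x where x: "x \<in> box p x0" and "AE v in lborel. ?P x v"
    using AE_ex_in_open[OF _ open_box] by blast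
  from lborel_AE_translate[OF this(2), of "- x"]
  have near: "AE y in lborel. y \<in> box x q \<longrightarrow> (\<forall>i. u i y = u i x)"
  proof eventually_elim
    case (elim y)
    show ?case
    proof (intro impI allI)
      fix i
      assume y: "y \<in> box x q"
      have "x \<in> box p q" "y \<in> box p q" "y + - x \<in> Q"
        using x y r by (auto simp: Q_def pq mem_box_cart intro: less_imp_le) (smt (verit))+
      with elim have "osc (y + - x) x = 0" by simp
      from osc_eq_0D[OF this, of i] show "u i y = u i x" by simp
    qed
  qed
  have "x0 \<in> box x q"
    using x r by (simp add: pq mem_box_cart)
  from open_contains_ball[THEN iffD1, OF open_box, rule_format, OF this]
  obtain \<rho> where \<rho>: "\<rho> > 0" "ball x0 \<rho> \<subseteq> box x q"
    by blast
  from near have "AE y in lborel. y \<in> ball x0 \<rho> \<longrightarrow> (\<forall>i. u i y = u i x)"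
    by eventually_elim (use subsetD[OF \<rho>(2)] in simp)
  with \<rho>(1) show ?thesis
    by (intro exI[of _ \<rho>] conjI exI[of _ "\<lambda>i. u i x"])
qed

text \<open>Points close to each other have the same local constant, so all points of the
  connected set \<open>\<Omega>\<close> do; countably many neighbourhoods cover \<open>\<Omega>\<close>.\<close>
lemma ex_AE_constant:
  assumes "connected \<Omega>" "\<Omega> \<noteq> {}"
  shows "\<exists>c. AE y in lborel. y \<in> \<Omega> \<longrightarrow> (\<forall>i. u i y = c i)"
proof -
  define C where "C x c \<longleftrightarrow> (\<exists>r>0. AE y in lborel. y \<in> ball x r \<longrightarrow> (\<forall>i. u i y = c i))" for x c
  have unique: "c = c'" if "C x c" "C x c'" for x c c'
  proof -
    from that obtain r r' where r: "r > 0" "r' > 0"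
      and "AE y in lborel. y \<in> ball x r \<longrightarrow> (\<forall>i. u i y = c i)"
        "AE y in lborel. y \<in> ball x r' \<longrightarrow> (\<forall>i. u i y = c' i)"
      unfolding C_def by blast
    from this(3,4) have "AE y in lborel. y \<in> ball x (min r r') \<longrightarrow> c = c'"
      by eventually_elim auto
    from AE_ex_in_open[OF this, of "ball x (min r r')"] r show ?thesis
      by auto
  qed
  obtain x0 where x0: "x0 \<in> \<Omega>"
    using assms(2) by blast
  obtain c where c: "C x0 c"
    using ex_AE_constant_near[OF x0] unfolding C_def by blast
  have all: "C x c" if "x \<in> \<Omega>" for x
  proof -
    have "\<exists>c. C x0 c \<and> C x c"
    proof (rule connected_equivalence_relation[OF assms(1) x0 that])
      show "\<exists>c. C y c \<and> C x c" if "\<exists>c. C x c \<and> C y c" for x y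
        using that by blast
      show "\<exists>c. C x c \<and> C z c" if "\<exists>c. C x c \<and> C y c" "\<exists>c. C y c \<and> C z c" for x y z
        using that unique by blast
      fix a
      assume a: "a \<in> \<Omega>"
      then obtain r c where r: "r > 0" "AE y in lborel. y \<in> ball a r \<longrightarrow> (\<forall>i. u i y = c i)"
        using ex_AE_constant_near by blast
      have Cr: "C x c" if x: "x \<in> ball a r" for x
      proof -
        obtain s where "s > 0" "ball x s \<subseteq> ball a r"
          using open_contains_ball[THEN iffD1, OF open_ball, rule_format, OF x] by blast
        moreover from r(2) have "AE y in lborel. y \<in> ball x s \<longrightarrow> (\<forall>i. u i y = c i)"
          by eventually_elim (use calculation in blast)
        ultimately show ?thesis unfolding C_def by blast
      qed
      from Cr[of a] r(1) have "C a c" by simp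
      with Cr have "\<forall>x\<in>\<Omega> \<inter> ball a r. \<exists>c. C a c \<and> C x c"
        by blast
      moreover have "openin (top_of_set \<Omega>) (\<Omega> \<inter> ball a r)" "a \<in> \<Omega> \<inter> ball a r"
        using r(1) a by auto
      ultimately show "\<exists>T. openin (top_of_set \<Omega>) T \<and> a \<in> T \<and> (\<forall>x\<in>T. \<exists>c. C a c \<and> C x c)"
        by blast
    qed
    then obtain c' where "C x0 c'" "C x c'"
      by blast
    with unique[OF c] show ?thesis by simp
  qed
  then have "\<forall>x\<in>\<Omega>. \<exists>r. r > 0 \<and> (AE y in lborel. y \<in> ball x r \<longrightarrow> (\<forall>i. u i y = c i))"
    unfolding C_def by auto
  from bchoice[OF this] obtain r where
    r: "\<forall>x\<in>\<Omega>. r x > 0 \<and> (AE y in lborel. y \<in> ball x (r x) \<longrightarrow> (\<forall>i. u i y = c i))" ..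
  obtain F where F: "F \<subseteq> (\<lambda>x. ball x (r x)) ` \<Omega>" "countable F" "\<Union>F = (\<Union>x\<in>\<Omega>. ball x (r x))"
    by (rule Lindelof[of "(\<lambda>x. ball x (r x)) ` \<Omega>"]) auto
  have "AE y in lborel. \<forall>U\<in>F. y \<in> U \<longrightarrow> (\<forall>i. u i y = c i)"
    using F(1) r by (subst AE_ball_countable[OF F(2)]) auto
  then have "AE y in lborel. y \<in> \<Omega> \<longrightarrow> (\<forall>i. u i y = c i)"
  proof eventually_elim
    case (elim y)
    show ?case
    proof
      assume "y \<in> \<Omega>"
      with r have "y \<in> ball y (r y)"
        by simp
      with \<open>y \<in> \<Omega>\<close> have "y \<in> \<Union>F"
        unfolding F(3) by blast
      with elim show "\<forall>i. u i y = c i" by blast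
    qed
  qed
  then show ?thesis
    by (rule exI[of _ c])
qed

end

section \<open>The Kuratowski embedding and Sobolev maps\<close>

text \<open>The left-hand side is at most \<open>dist a b\<close>.  For \<open>z i\<close> close to \<open>a\<close>, the \<open>i\<close>-th term on the right is
  nearly \<open>dist b a + dist c a\<close>, because the distance to \<open>z i\<close> has a minimum near \<open>a\<close>.\<close>
lemma kuratowski_second_difference:
  assumes dense: "closure (range z) = UNIV"
  shows "(SUP i. ennreal \<bar>apply_bcontfun (kuratowski z b) i - apply_bcontfun (kuratowski z a) i\<bar>) \<le>
    (SUP i. ennreal \<bar>apply_bcontfun (kuratowski z b) i - 2 * apply_bcontfun (kuratowski z a) i +
      apply_bcontfun (kuratowski z c) i\<bar>)" (is "_ \<le> ?R")
proof -
  have "ennreal (dist a b) \<le> ?R"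
  proof (rule ennreal_le_epsilon)
    fix e :: real
    assume "e > 0"
    \<comment> \<open>The distance of z i and a enters three times below: once through the triangle inequality, and twice subtracted.\<close>
    then obtain i where i: "dist (z i) a < e / 3"
      using closure_approachable[of a "range z"] unfolding dense by (auto dest: spec[of _ "e / 3"])
    have "dist a b \<le> \<bar>dist b (z i) - 2 * dist a (z i) + dist c (z i)\<bar> + e"
    proof -
      have "dist a b \<le> dist a (z i) + dist b (z i)" "0 \<le> dist c (z i)" "dist a (z i) < e / 3"
        using i by (auto simp: dist_commute intro: dist_triangle2)
      then show ?thesis by linarith
    qed
    then have "ennreal (dist a b) \<le> ennreal \<bar>apply_bcontfun (kuratowski z b) i -
        2 * apply_bcontfun (kuratowski z a) i + apply_bcontfun (kuratowski z c) i\<bar> + ennreal e"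
      using \<open>e > 0\<close> by (simp add: kuratowski_apply ennreal_leI flip: ennreal_plus)
    also have "\<dots> \<le> ?R + ennreal e"
      by (intro add_right_mono SUP_upper) simp
    finally show "ennreal (dist a b) \<le> ?R + ennreal e" .
  qed
  then have "ennreal \<bar>apply_bcontfun (kuratowski z b) i - apply_bcontfun (kuratowski z a) i\<bar> \<le> ?R" for i
  proof (rule order.trans[rotated])
    show "ennreal \<bar>apply_bcontfun (kuratowski z b) i - apply_bcontfun (kuratowski z a) i\<bar> \<le> ennreal (dist a b)"
      using dist_triangle[of b "z i" a] dist_triangle[of a "z i" b]
      by (intro ennreal_leI) (simp add: kuratowski_apply dist_commute abs_le_iff)
  qed
  then show ?thesis
    by (rule SUP_least)
qed

lemma kuratowski_inject:
  assumes dense: "closure (range z) = UNIV"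
    and eq: "\<And>i. apply_bcontfun (kuratowski z a) i = apply_bcontfun (kuratowski z b) i"
  shows "a = b"
proof -
  have near: "\<exists>i. dist (z i) a < e" if "e > 0" for e
    using closure_approachable[of a "range z"] that unfolding dense by auto
  have "dist a b < e" if "e > 0" for e
  proof -
    obtain i where i: "dist (z i) a < e / 2"
      using near[of "e / 2"] \<open>e > 0\<close> by auto
    have "dist a (z i) = dist b (z i)" "dist a (z i) < e / 2"
      using eq[of i] i by (simp_all add: kuratowski_apply dist_commute)
    with dist_triangle2[of a b "z i"] show ?thesis
      by linarith
  qed
  from this[of "dist a b"] show ?thesis
    by (metis less_irrefl zero_less_dist_iff)
qed

lemma integrable_Lp_space_coordinate:
  fixes F :: "real^'n \<Rightarrow> linf"
  assumes F: "F \<in> Lp_space p \<Omega>" and p: "1 \<le> p" and \<Omega>: "\<Omega> \<in> lmeasurable"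
  shows "integrable (lebesgue_on \<Omega>) (\<lambda>x. apply_bcontfun (F x) i)"
proof -
  have meas: "F \<in> borel_measurable (lebesgue_on \<Omega>)"
    and int: "integrable (lebesgue_on \<Omega>) (\<lambda>x. norm (F x) powr p)"
    using F by (simp_all add: Lp_space_def)
  have "continuous_on UNIV (\<lambda>f :: linf. apply_bcontfun f i)"
    by (rule bounded_linear.continuous_on[OF bounded_linear_apply_bcontfun continuous_on_id])
  then have coord: "(\<lambda>x. apply_bcontfun (F x) i) \<in> borel_measurable (lebesgue_on \<Omega>)"
    by (intro measurable_compose[OF meas] borel_measurable_continuous_onI)
  have int1: "integrable (lebesgue_on \<Omega>) (\<lambda>x. 1 + norm (F x) powr p)"
    using finite_measure.integrable_const[OF finite_measure_lebesgue_on[OF \<Omega>]] int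
    by (intro Bochner_Integration.integrable_add)
  have bound: "norm (apply_bcontfun (F x) i) \<le> norm (1 + norm (F x) powr p)" for x
  proof -
    have "norm (F x) \<le> 1 + norm (F x) powr p"
    proof (cases "norm (F x) \<le> 1")
      case False
      then have "norm (F x) powr 1 \<le> norm (F x) powr p"
        using p by (intro powr_mono) auto
      with False show ?thesis by simp
    qed (simp add: add_increasing2)
    with norm_bounded[of "F x" i] show ?thesis by simp
  qed
  show ?thesis
    by (rule Bochner_Integration.integrable_bound[OF int1 coord AE_I2]) (rule bound)
qed

text \<open>A bump vanishes on the boundary of its box, so a larger box is needed for a positive lower bound.\<close>
lemma test_function_positive_on_cbox:
  fixes \<Omega> :: "(real^'n) set"
  assumes "cbox p q \<subseteq> box a b" "cbox a b \<subseteq> \<Omega>"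
  shows "\<exists>\<phi>\<in>test_functions \<Omega>. \<exists>c>0. \<forall>x\<in>cbox p q. c \<le> \<phi> x"
proof -
  define \<phi> where "\<phi> = box_bump 1 a b"
  have \<phi>: "\<phi> \<in> test_functions \<Omega>"
    unfolding \<phi>_def using assms by (intro box_bump_test_function) auto
  show ?thesis
  proof (cases "cbox p q = {}")
    case True
    with \<phi> show ?thesis by (auto intro!: bexI[of _ \<phi>] exI[of _ 1])
  next
    case False
    have "continuous_on (cbox p q) \<phi>"
      using test_function_continuous[OF \<phi>] continuous_on_subset by blast
    from continuous_attains_inf[OF compact_cbox False this]
    obtain x where x: "x \<in> cbox p q" "\<And>y. y \<in> cbox p q \<Longrightarrow> \<phi> x \<le> \<phi> y"
      by blast
    have "\<phi> x \<noteq> 0" "0 \<le> \<phi> x"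
      using x(1) assms box_bump_eq_0_iff[of 1 a b x] box_bump_bounds(1)[of 1 a b x] by (auto simp: \<phi>_def)
    with x \<phi> show ?thesis
      by (intro bexI[of _ \<phi>] exI[of _ "\<phi> x"]) auto
  qed
qed

text \<open>The coordinates of \<open>F\<close> and of its weak derivatives form a family as in the preceding section.\<close>
lemma sobolev_metric_imp_AE_constant:
  fixes \<Omega> :: "(real^'n) set" and z :: "nat \<Rightarrow> 'a::metric_space"
  assumes \<Omega>: "open \<Omega>" "connected \<Omega>" "\<Omega> \<noteq> {}" "bounded \<Omega>"
    and dense: "closure (range z) = UNIV" and p: "1 \<le> p"
    and f: "f \<in> sobolev_metric z p \<Omega>"
  shows "\<exists>c. AE x in lebesgue_on \<Omega>. f x = c"
proof -
  define F where "F = kuratowski z \<circ> f"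
  have m: "\<Omega> \<in> lmeasurable" and ms: "\<Omega> \<in> sets lebesgue"
    using \<Omega> by (auto simp: lmeasurable_open)
  have F: "F \<in> Lp_space p \<Omega>" and "\<forall>j. \<exists>g \<in> Lp_space p \<Omega>. weak_partial_deriv \<Omega> j F g"
    using f by (auto simp: F_def sobolev_metric_def sobolev_banach_def)
  then have "\<forall>j. \<exists>g. g \<in> Lp_space p \<Omega> \<and> weak_partial_deriv \<Omega> j F g"
    by blast
  from choice[OF this] obtain G where
    G: "\<And>j. G j \<in> Lp_space p \<Omega>" "\<And>j. weak_partial_deriv \<Omega> j F (G j)"
    by blast
  have ver: "\<exists>w. w \<in> borel_measurable borel \<and>
      (AE x in lborel. w x = indicator \<Omega> x * apply_bcontfun (H x) i) \<and> integrable lborel w" if H: "H \<in> Lp_space p \<Omega>" for H :: "real^'n \<Rightarrow> linf" and i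
  proof -
    note int = integrable_Lp_space_coordinate[OF H p m, of i]
    have meas: "(\<lambda>x. apply_bcontfun (H x) i) \<in> borel_measurable (lebesgue_on \<Omega>)"
      using int by simp
    from borel_version_on[OF meas ms] obtain w where w: "w \<in> borel_measurable borel"
        "AE x in lborel. w x = indicator \<Omega> x * apply_bcontfun (H x) i"
      by blast
    with borel_version_integrable_iff[OF meas ms w] int show ?thesis by blast
  qed
  have versions: "\<exists>w. \<forall>i. w i \<in> borel_measurable borel \<and>
      (AE x in lborel. w i x = indicator \<Omega> x * apply_bcontfun (H x) i) \<and> integrable lborel (w i)"
    if H: "H \<in> Lp_space p \<Omega>" for H :: "real^'n \<Rightarrow> linf"
    by (rule choice) (rule allI, rule ver[OF H])
  from versions[OF F] obtain u where "\<forall>i. u i \<in> borel_measurable borel \<and>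
      (AE x in lborel. u i x = indicator \<Omega> x * apply_bcontfun (F x) i) \<and> integrable lborel (u i)" ..
  then have u: "\<And>i. u i \<in> borel_measurable borel"
      "\<And>i. AE x in lborel. u i x = indicator \<Omega> x * apply_bcontfun (F x) i" "\<And>i. integrable lborel (u i)"
    by simp_all
  from choice[OF allI[OF versions[OF G(1)]]] obtain g where "\<forall>j i. g j i \<in> borel_measurable borel \<and>
      (AE x in lborel. g j i x = indicator \<Omega> x * apply_bcontfun (G j x) i) \<and> integrable lborel (g j i)" ..
  then have g: "\<And>j i. g j i \<in> borel_measurable borel"
      "\<And>j i. AE x in lborel. g j i x = indicator \<Omega> x * apply_bcontfun (G j x) i" "\<And>j i. integrable lborel (g j i)"
    by simp_all
  define A where "A = {x \<in> \<Omega>. \<forall>i. u i x = apply_bcontfun (F x) i}"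
  have coord: "(LINT x|lborel. w x * \<psi> x) = apply_bcontfun v i"
    if w: "w \<in> borel_measurable borel" "AE x in lborel. w x = indicator \<Omega> x * apply_bcontfun (H x) i"
      and \<psi>: "\<psi> \<in> borel_measurable borel"
      and int: "has_bochner_int (lebesgue_on \<Omega>) (\<lambda>x. \<psi> x *\<^sub>R H x) v"
    for w \<psi> i v and H :: "real^'n \<Rightarrow> linf"
  proof -
    have int': "has_bochner_integral (lebesgue_on \<Omega>) (\<lambda>x. apply_bcontfun (\<psi> x *\<^sub>R H x) i) (apply_bcontfun v i)"
      by (rule has_bochner_int_bounded_linear[OF int bounded_linear_apply_bcontfun])
    have "(LINT x|lborel. w x * \<psi> x) = integral\<^sup>L (lebesgue_on \<Omega>) (\<lambda>x. apply_bcontfun (\<psi> x *\<^sub>R H x) i)"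
    proof (rule borel_version_integral_eq[symmetric, OF _ ms])
      show "(\<lambda>x. apply_bcontfun (\<psi> x *\<^sub>R H x) i) \<in> borel_measurable (lebesgue_on \<Omega>)"
        using int' by (rule borel_measurable_has_bochner_integral)
      show "(\<lambda>x. w x * \<psi> x) \<in> borel_measurable borel"
        using w(1) \<psi> by simp
      show "AE x in lborel. w x * \<psi> x = indicator \<Omega> x * apply_bcontfun (\<psi> x *\<^sub>R H x) i"
        using w(2) by eventually_elim (simp add: scaleR_bcontfun.rep_eq)
    qed
    also have "\<dots> = apply_bcontfun v i"
      using int' by (rule has_bochner_integral_integral_eq)
    finally show ?thesis .
  qed
  interpret kuratowski_sobolev_family \<Omega> u g A
  proof
    show "open \<Omega>" by (rule \<Omega>)
    show "integrable lborel (u i)" "integrable lborel (g j i)" for i j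
      by (rule u g)+
    show "(LINT x|lborel. u i x * partial_deriv j \<phi> x) = - (LINT x|lborel. g j i x * \<phi> x)"
      if \<phi>: "\<phi> \<in> test_functions \<Omega>" for i j \<phi>
    proof -
      obtain v where v: "has_bochner_int (lebesgue_on \<Omega>) (\<lambda>x. partial_deriv j \<phi> x *\<^sub>R F x) v"
          "has_bochner_int (lebesgue_on \<Omega>) (\<lambda>x. \<phi> x *\<^sub>R G j x) (- v)"
        using G(2)[of j] \<phi> unfolding weak_partial_deriv_def by blast
      have "\<phi> \<in> borel_measurable borel" "partial_deriv j \<phi> \<in> borel_measurable borel"
        using test_function_continuous[OF \<phi>] test_function_continuous_deriv[OF \<phi>]
        by (auto intro: borel_measurable_continuous_onI)
      with coord[OF u(1,2) _ v(1)] coord[OF g(1,2) _ v(2)] show ?thesis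
        by (simp add: uminus_bcontfun.rep_eq)
    qed
    have "AE x in lborel. \<forall>i. u i x = indicator \<Omega> x * apply_bcontfun (F x) i"
      using u(2) by (simp add: AE_all_countable)
    then show "AE x in lborel. x \<in> \<Omega> \<longrightarrow> x \<in> A"
      by eventually_elim (auto simp: A_def)
    show "(SUP i. ennreal \<bar>u i y - u i x\<bar>) \<le> (SUP i. ennreal \<bar>u i y - 2 * u i x + u i w\<bar>)"
      if "x \<in> A" "y \<in> A" "w \<in> A" for x y w
      using that kuratowski_second_difference[OF dense, of "f y" "f x" "f w"]
      by (simp add: A_def F_def)
    show "(\<lambda>k. \<integral>\<^sup>+x. (SUP i. ennreal \<bar>indicator (cbox p q) (x + s k) * g j i (x + s k) -
            indicator (cbox p q) x * g j i x\<bar>) \<partial>lborel) \<longlonglongrightarrow> 0"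
      if K: "cbox p q \<subseteq> box a b" "cbox a b \<subseteq> \<Omega>" and s: "s \<longlonglongrightarrow> 0" for j p q a b s
    proof -
      have meas: "(\<lambda>x. indicator (cbox p q) x * g j i x) \<in> borel_measurable borel" for i
        using g(1) by simp
      have bound: "\<bar>apply_bcontfun v i\<bar> \<le> norm v" for v :: linf and i
        using norm_bounded[of v i] by simp
      obtain \<phi> c where \<phi>: "\<phi> \<in> test_functions \<Omega>" "c > 0" "\<And>x. x \<in> cbox p q \<Longrightarrow> c \<le> \<phi> x"
        using test_function_positive_on_cbox[OF K] by blast
      obtain v where v: "has_bochner_int (lebesgue_on \<Omega>) (\<lambda>x. \<phi> x *\<^sub>R G j x) (- v)"
        using G(2)[of j] \<phi>(1) unfolding weak_partial_deriv_def by blast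
      have "AE x in lborel. \<forall>i. g j i x = indicator \<Omega> x * apply_bcontfun (G j x) i"
        using g(2) by (simp add: AE_all_countable)
      moreover have "cbox p q \<subseteq> \<Omega>"
        using K box_subset_cbox[of a b] by blast
      moreover have "\<phi> \<in> borel_measurable borel"
        using test_function_continuous[OF \<phi>(1)] by (rule borel_measurable_continuous_onI)
      ultimately have approx: "\<exists>S d. finite S \<and> (\<forall>b\<in>S. integrable lborel (d b)) \<and>
          (\<integral>\<^sup>+x. (SUP i. ennreal \<bar>indicator (cbox p q) x * g j i x - (\<Sum>b\<in>S. apply_bcontfun b i * d b x)\<bar>) \<partial>lborel) \<le> \<epsilon>"
        if "\<epsilon> > 0" for \<epsilon> :: real
        using that by (intro finite_rank_approximation[OF v ms _ _ _ \<phi>(2,3)]) auto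
      show ?thesis
        by (rule L1_sup_translation_null[OF meas s bound approx])
    qed
  qed
  obtain c where c: "AE y in lborel. y \<in> \<Omega> \<longrightarrow> (\<forall>i. u i y = c i)"
    using ex_AE_constant[OF \<Omega>(2,3)] by blast
  with A have ae: "AE y in lborel. y \<in> \<Omega> \<longrightarrow> y \<in> A \<and> (\<forall>i. u i y = c i)"
    by eventually_elim auto
  from AE_ex_in_open[OF ae \<Omega>(1,3)] obtain y0 where y0: "y0 \<in> A" "\<And>i. u i y0 = c i"
    by blast
  have "AE y in lborel. y \<in> \<Omega> \<longrightarrow> f y = f y0"
    using ae
  proof eventually_elim
    case (elim y)
    show ?case
    proof
      assume "y \<in> \<Omega>"
      with elim y0 show "f y = f y0"
        by (intro kuratowski_inject[OF dense]) (auto simp: A_def F_def)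
    qed
  qed
  then have "AE y in lebesgue_on \<Omega>. f y = f y0"
    using ms by (subst AE_restrict_space_iff) (auto intro: AE_completion)
  then show ?thesis by blast
qed

text \<open>This uses only the completeness of Lebesgue measure, so it also covers nonseparable targets.\<close>
lemma borel_measurable_lebesgue_on_cong_AE:
  assumes ae: "AE x in lebesgue_on \<Omega>. F x = H x" and H: "H \<in> borel_measurable (lebesgue_on \<Omega>)"
    and \<Omega>: "\<Omega> \<in> sets lebesgue"
  shows "F \<in> borel_measurable (lebesgue_on \<Omega>)"
proof (rule measurableI)
  fix S :: "'b set"
  assume S: "S \<in> sets borel"
  have "AE x in lebesgue. x \<in> \<Omega> \<longrightarrow> F x = H x"
    using ae \<Omega> by (subst (asm) AE_restrict_space_iff) auto
  then obtain N where N: "N \<in> null_sets lebesgue" "{x. \<not> (x \<in> \<Omega> \<longrightarrow> F x = H x)} \<subseteq> N"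
    unfolding eventually_ae_filter by auto
  define D where "D = {x \<in> \<Omega>. F x \<noteq> H x}"
  \<comment> \<open>All subsets of the exceptional set are measurable, so changing the function there is harmless.\<close>
  have sub: "E \<in> sets (lebesgue_on \<Omega>)" if "E \<subseteq> D" for E
  proof -
    have "E \<in> null_sets lebesgue"
      using that N by (intro null_sets_completion_subset[OF _ N(1)]) (auto simp: D_def)
    then show ?thesis
      using that \<Omega> by (auto simp: sets_restrict_space_iff D_def)
  qed
  have "F -` S \<inter> space (lebesgue_on \<Omega>) =
      (H -` S \<inter> space (lebesgue_on \<Omega>) - D) \<union> (F -` S \<inter> D)"
    by (auto simp: D_def)
  also have "\<dots> \<in> sets (lebesgue_on \<Omega>)"
    using sub[of D] sub[of "F -` S \<inter> D"] measurable_sets[OF H S] by auto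
  finally show "F -` S \<inter> space (lebesgue_on \<Omega>) \<in> sets (lebesgue_on \<Omega>)" .
qed simp

lemma AE_const_in_Lp_space:
  fixes F :: "real^'n \<Rightarrow> 'b::banach"
  assumes ae: "AE x in lebesgue_on \<Omega>. F x = c" and \<Omega>: "\<Omega> \<in> lmeasurable"
  shows "F \<in> Lp_space p \<Omega>"
proof -
  have ms: "\<Omega> \<in> sets lebesgue" using \<Omega> by auto
  have F: "F \<in> borel_measurable (lebesgue_on \<Omega>)"
    by (rule borel_measurable_lebesgue_on_cong_AE[OF ae _ ms]) simp
  obtain N where N: "N \<in> null_sets (lebesgue_on \<Omega>)" "{x \<in> \<Omega>. F x \<noteq> c} \<subseteq> N"
    using ae unfolding eventually_ae_filter by auto
  have "F ` (\<Omega> - N) \<subseteq> {c}"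
    using N(2) by auto
  then have "countable (F ` (\<Omega> - N))"
    by (rule countable_subset) simp
  then have "separable_space (top_of_set (F ` (\<Omega> - N)))"
    unfolding separable_space_def by (intro exI[of _ "F ` (\<Omega> - N)"]) (use closure_of_topspace[of "top_of_set (F ` (\<Omega> - N))"] in simp)
  with N(1) have "ess_separably_valued \<Omega> F"
    unfolding ess_separably_valued_def by blast
  moreover have "integrable (lebesgue_on \<Omega>) (\<lambda>x. norm (F x) powr p)"
  proof (rule integrable_cong_AE_imp)
    show "integrable (lebesgue_on \<Omega>) (\<lambda>x. norm c powr p)"
      by (rule finite_measure.integrable_const[OF finite_measure_lebesgue_on[OF \<Omega>]])
    show "(\<lambda>x. norm (F x) powr p) \<in> borel_measurable (lebesgue_on \<Omega>)"
      using F by (intro powr_real_measurable borel_measurable_norm) auto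
    show "AE x in lebesgue_on \<Omega>. norm c powr p = norm (F x) powr p"
      using ae by eventually_elim simp
  qed
  ultimately show ?thesis
    using F by (simp add: Lp_space_def)
qed

text \<open>Translating \<open>\<phi>\<close> does not change its integral, and the difference of the integrals is the average
  of the integrals of translates of the partial derivative, which all agree.\<close>
lemma test_function_integral_partial_deriv:
  fixes \<Omega> :: "(real^'n) set"
  assumes \<phi>: "\<phi> \<in> test_functions \<Omega>" and \<Omega>: "bounded \<Omega>"
  shows "integrable lborel (partial_deriv j \<phi>)" "(LINT x|lborel. partial_deriv j \<phi> x) = 0"
proof -
  let ?d = "partial_deriv j \<phi>" and ?e = "axis j 1 :: real^'n"
  obtain R where R: "\<And>x. x \<in> \<Omega> \<Longrightarrow> norm x \<le> R"
    using \<Omega> by (auto simp: bounded_iff)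
  \<comment> \<open>The constant function 1, cut off far enough out to be integrable: translations of the support by at most 1 do not leave it.\<close>
  define u where "u = (indicator (cball 0 (R + 1)) :: real^'n \<Rightarrow> real)"
  have u: "integrable lborel u"
    unfolding u_def by (intro integrable_real_indicator) (auto intro: emeasure_bounded_finite[unfolded infinity_ennreal_def])
  have u1: "u x * w (x - t *\<^sub>R ?e) = w (x - t *\<^sub>R ?e)"
    if "\<And>x. x \<notin> \<Omega> \<Longrightarrow> w x = 0" "t \<in> {0..1}" for w :: "real^'n \<Rightarrow> real" and x t
  proof (cases "x - t *\<^sub>R ?e \<in> \<Omega>")
    case True
    have "norm x \<le> norm (x - t *\<^sub>R ?e) + norm (t *\<^sub>R ?e)"
      using norm_triangle_ineq[of "x - t *\<^sub>R ?e" "t *\<^sub>R ?e"] by simp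
    then show ?thesis
      using R[OF True] that(2) by (simp add: u_def norm_axis_1)
  qed (simp add: that)
  have int: "integrable lborel w"
    if w: "\<And>x. x \<notin> \<Omega> \<Longrightarrow> w x = 0" "continuous_on UNIV w" "\<exists>C. \<forall>x. \<bar>w x\<bar> \<le> C" for w :: "real^'n \<Rightarrow> real"
  proof -
    obtain C where C: "\<And>x. \<bar>w x\<bar> \<le> C" using w(3) by blast
    show ?thesis
    proof (rule Bochner_Integration.integrable_bound)
      show "integrable lborel (\<lambda>x. C * u x)" using u by simp
      show "w \<in> borel_measurable lborel"
        using borel_measurable_continuous_onI[OF w(2)] by simp
      show "AE x in lborel. norm (w x) \<le> norm (C * u x)"
      proof (rule AE_I2)
        fix x
        have "\<bar>w x\<bar> = \<bar>u x * w x\<bar>"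
          using u1[of w 0 x] w(1) by auto
        also have "\<dots> \<le> \<bar>u x\<bar> * \<bar>C\<bar>"
          using C[of x] by (simp add: abs_mult mult_left_mono)
        finally show "norm (w x) \<le> norm (C * u x)" by (simp add: abs_mult mult.commute)
      qed
    qed
  qed
  note zero = test_function_outside[OF \<phi>] test_function_deriv_outside[OF \<phi>]
  have \<phi>i: "integrable lborel \<phi>"
    by (intro int zero test_function_continuous[OF \<phi>] test_function_bounded[OF \<phi>])
  show di: "integrable lborel ?d"
    by (intro int zero test_function_continuous_deriv[OF \<phi>] test_function_deriv_bounded[OF \<phi>])
  have tr: "(LINT x|lborel. w (x - t *\<^sub>R ?e)) = (LINT x|lborel. w x)"
    "integrable lborel (\<lambda>x. w (x - t *\<^sub>R ?e))" if "integrable lborel w" for w :: "real^'n \<Rightarrow> real" and t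
    using lborel_integral_translate[of w "- t *\<^sub>R ?e"] lborel_integrable_translate[of w "- t *\<^sub>R ?e"] that by auto
  have "(LINT x|lborel. u x * (\<phi> (x - 1 *\<^sub>R ?e) - \<phi> x)) =
      (LINT x|lborel. \<phi> (x - 1 *\<^sub>R ?e) - \<phi> x)"
  proof -
    have "u x * \<phi> (x - 1 *\<^sub>R ?e) = \<phi> (x - 1 *\<^sub>R ?e)" "u x * \<phi> x = \<phi> x" for x
      using u1[of \<phi> 1 x] u1[of \<phi> 0 x] zero(1) by (simp_all del: mult_cancel_right1 mult_cancel_right2)
    then show ?thesis
      by (simp only: right_diff_distrib)
  qed
  also have "\<dots> = 0"
    using tr[OF \<phi>i, of 1] \<phi>i by simp
  finally have "(LINT t|lborel. indicator {0..1} t * (LINT x|lborel. u x * ?d (x - t *\<^sub>R ?e))) = 0"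
    using integral_test_function_difference[OF u \<phi>, of 1 j] by simp
  also have "(LINT t|lborel. indicator {0..1} t * (LINT x|lborel. u x * ?d (x - t *\<^sub>R ?e))) =
      (LINT t|lborel. indicator {0..1::real} t * (LINT x|lborel. ?d x))"
  proof (rule Bochner_Integration.integral_cong[OF refl])
    fix t
    show "indicator {0..1} t * (LINT x|lborel. u x * ?d (x - t *\<^sub>R ?e)) =
        indicator {0..1} t * (LINT x|lborel. ?d x)"
    proof (cases "t \<in> {0..1}")
      case True
      have "u x * ?d (x - t *\<^sub>R ?e) = ?d (x - t *\<^sub>R ?e)" for x
        by (rule u1) (use True zero(2) in auto)
      with tr(1)[OF di, of t] show ?thesis by (simp only:)
    qed simp
  qed
  finally show "(LINT x|lborel. ?d x) = 0" by simp
qed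

lemma AE_constant_imp_sobolev_metric:
  fixes \<Omega> :: "(real^'n) set"
  assumes \<Omega>: "open \<Omega>" "bounded \<Omega>" and ae: "AE x in lebesgue_on \<Omega>. f x = c"
  shows "f \<in> sobolev_metric z p \<Omega>"
proof -
  let ?M = "lebesgue_on \<Omega>"
  define F where "F = kuratowski z \<circ> f"
  define k where "k = kuratowski z c"
  have m: "\<Omega> \<in> lmeasurable" and ms: "\<Omega> \<in> sets lebesgue"
    using \<Omega> by (auto simp: lmeasurable_open)
  have aeF: "AE x in ?M. F x = k"
    using ae by eventually_elim (simp add: F_def k_def)
  have "weak_partial_deriv \<Omega> j F (\<lambda>_. 0)" for j
    unfolding weak_partial_deriv_def
  proof (intro ballI exI conjI)
    fix \<phi>
    assume \<phi>: "\<phi> \<in> test_functions \<Omega>"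
    let ?d = "partial_deriv j \<phi>"
    note d = test_function_integral_partial_deriv[OF \<phi> \<Omega>(2), of j]
    have dm: "?d \<in> borel_measurable borel"
      using d(1) by simp
    have dm': "?d \<in> borel_measurable ?M"
      by (intro measurable_restrict_space1 measurable_completion) (use dm in simp)
    have eq: "AE x in lborel. ?d x = indicator \<Omega> x * ?d x"
      using test_function_deriv_outside[OF \<phi>] by (intro AE_I2) (auto simp: indicator_def)
    have "has_bochner_integral ?M ?d 0"
      using borel_version_integrable_iff[OF dm' ms dm eq] borel_version_integral_eq[OF dm' ms dm eq] d
      by (simp add: has_bochner_integral_iff)
    from has_bochner_int_scaleR_left[OF this, of k]
    obtain s where s: "\<forall>i. Bochner_Integration.simple_bochner_integrable ?M (s i)"
        "(\<lambda>i. \<integral>\<^sup>+x. ennreal (norm (?d x *\<^sub>R k - s i x)) \<partial>?M) \<longlonglongrightarrow> 0"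
        "(\<lambda>i. Bochner_Integration.simple_bochner_integral ?M (s i)) \<longlonglongrightarrow> 0"
      and meas: "(\<lambda>x. ?d x *\<^sub>R k) \<in> borel_measurable ?M"
      unfolding has_bochner_int_def by auto
    have aed: "AE x in ?M. ?d x *\<^sub>R F x = ?d x *\<^sub>R k"
      using aeF by eventually_elim simp
    have "(\<integral>\<^sup>+x. ennreal (norm (?d x *\<^sub>R F x - s i x)) \<partial>?M) =
        (\<integral>\<^sup>+x. ennreal (norm (?d x *\<^sub>R k - s i x)) \<partial>?M)" for i
      using aed by (intro nn_integral_cong_AE) (auto elim: eventually_mono)
    with s borel_measurable_lebesgue_on_cong_AE[OF aed meas ms]
    show "has_bochner_int ?M (\<lambda>x. ?d x *\<^sub>R F x) 0"
      unfolding has_bochner_int_def by auto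
    show "has_bochner_int ?M (\<lambda>x. \<phi> x *\<^sub>R (0 :: linf)) (- 0)"
      using has_bochner_int_scaleR_left[of ?M "\<lambda>_. 0" 0 "0 :: linf"] by auto
  qed
  moreover have "(\<lambda>_. 0) \<in> Lp_space p \<Omega>"
    by (rule AE_const_in_Lp_space[where c=0, OF _ m]) simp
  ultimately show ?thesis
    using AE_const_in_Lp_space[OF aeF m]
    unfolding sobolev_metric_def sobolev_banach_def F_def by blast
qed

theorem theorem1p2:
  fixes \<Omega> :: "(real^'n) set"
    and z :: "nat \<Rightarrow> 'a::polish_space"
    and p :: real
    and f :: "real^'n \<Rightarrow> 'a"
  assumes "open \<Omega>" and "connected \<Omega>" and "\<Omega> \<noteq> {}" and "bounded \<Omega>"
    and "closure (range z) = UNIV"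
    and "1 \<le> p"
  shows "f \<in> sobolev_metric z p \<Omega> \<longleftrightarrow> (\<exists>c. AE x in lebesgue_on \<Omega>. f x = c)"
  using sobolev_metric_imp_AE_constant[OF assms] AE_constant_imp_sobolev_metric[OF assms(1,4)]
  by blast

end
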